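(* Let $\Sigma\subset[0,\infty)$ be an additive semigroup with $0\in\Sigma$, and suppose that $\mathbb{H}_+$ is dense in $M(AP_\Sigma)$. Let $1\le k<n$ be integers and let $A=(a_{ij})$ be an $n\times k$ matrix with entries $a_{ij}\in AP_\Sigma$. Let $f_1,\dots,f_N\in AP_\Sigma$ be the family of determinants of all $k\times k$ submatrices of $A$, and assume that $$\inf_{z\in\mathbb{H}_+}\sum_{l=1}^{N}|\hat f_l(z)|>0 .$$ Then there is an $n\times n$ matrix $\widetilde A=(\widetilde a_{ij})$ with all $\widetilde a_{ij}\in AP_\Sigma$ such that $\widetilde a_{ij}=a_{ij}$ for $1\le j\le k$, $1\le i\le n$, and $\det(\widetilde A)=1$.
   Context: The algebra $AP$ of (uniformly) almost periodic functions is the smallest closed subalgebra of $L^\infty(\mathbb{R})$ (complex-valued, sup norm) containing all functions $e_\lambda(x):=e^{i\lambda x}$, $\lambda\in\mathbb{R}$. An almost periodic polynomial is a finite sum $\sum_j r_j e_{\lambda_j}$ with $r_j\in\mathbb{C}$, $\lambda_j\in\mathbb{R}$; the set of these is $AP^0$. The Bohr-Fourier spectrum of $a\in AP$ is $\Omega(a):=\{\lambda\in\mathbb{R} : \lim_{N\to\infty}\frac{1}{2N}\int_{-N}^{N}a(x)e_{-\lambda}(x)\,dx\neq 0\}$. A set $\Sigma\subset[0,\infty)$ is an additive semigroup if $\lambda,\mu\in\Sigma$ implies $\lambda+\mu\in\Sigma$. For such $\Sigma$ with $0\in\Sigma$, put $AP_\Sigma^0:=\{a\in AP^0 : \Omega(a)\subset\Sigma\}$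 and let $AP_\Sigma$ be the closure of $AP_\Sigma^0$ in $AP$; it is a unital commutative Banach algebra (and equals $\{a\in AP:\Omega(a)\subset\Sigma\}$). $M(AP_\Sigma)$ denotes the set of nonzero algebra homomorphisms $AP_\Sigma\to\mathbb{C}$ equipped with the weak$^*$ (Gelfand) topology. $\mathbb{H}_+$ is the open upper half-plane in $\mathbb{C}$. Each $a\in AP_\Sigma$ extends by the Poisson integral formula to a holomorphic function $\hat a$ on $\mathbb{H}_+$, with $\sup_{\mathbb{H}_+}|\hat a|=\sup_{\mathbb{R}}|a|$. The map sending $z\in\mathbb{H}_+$ to the evaluation homomorphism $a\mapsto\hat a(z)$ maps $\mathbb{H}_+$ into $M(AP_\Sigma)$; "$\mathbb{H}_+$ is dense in $M(AP_\Sigma)$" means that the image of this map is dense in the Gelfand topology. *)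

theory Defs
  imports
    "HOL-Analysis.Analysis"
    "Jordan_Normal_Form.Determinant"
    "Jordan_Normal_Form.DL_Submatrix"
begin

subsection \<open>Bounded continuous functions as a commutative ring\<close>

unbundle bcontfun.lifting

instantiation bcontfun :: (topological_space, real_normed_field) comm_ring_1
begin

lift_definition one_bcontfun :: "'a \<Rightarrow>\<^sub>C 'b" is "\<lambda>_. 1"
  by (rule const_bcontfun)

lift_definition times_bcontfun :: "('a \<Rightarrow>\<^sub>C 'b) \<Rightarrow> ('a \<Rightarrow>\<^sub>C 'b) \<Rightarrow> 'a \<Rightarrow>\<^sub>C 'b"
  is "\<lambda>f g x. f x * g x"
proof -
  fix f g :: "'a \<Rightarrow> 'b"
  assume f: "f \<in> bcontfun" and g: "g \<in> bcontfun"
  from f obtain b where b: "\<And>x. norm (f x) \<le> b"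
    by (auto simp: bcontfun_def bounded_iff)
  from g obtain c where c: "\<And>x. norm (g x) \<le> c"
    by (auto simp: bcontfun_def bounded_iff)
  have "norm (f x * g x) \<le> b * c" for x
    using mult_mono'[OF b[of x] c[of x]] by (simp add: norm_mult)
  then show "(\<lambda>x. f x * g x) \<in> bcontfun"
    using f g by (auto simp: bcontfun_def bounded_iff intro!: continuous_intros)
qed

instance
proof
  show "(0 :: 'a \<Rightarrow>\<^sub>C 'b) \<noteq> 1"
    by transfer (simp add: fun_eq_iff)
qed (transfer, simp add: algebra_simps)+

end

lemmas [simp] = one_bcontfun.rep_eq times_bcontfun.rep_eq const_bcontfun.rep_eq

subsection \<open>Almost periodic functions\<close>

text \<open>
  The functions \<open>e\<^sub>\<lambda>(x) = exp (i \<lambda> x)\<close> are bounded and continuous, and the bounded continuous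
  functions form a closed subalgebra of \<open>L\<^sup>\<infinity>(\<real>)\<close> (isometrically: the essential supremum of a
  continuous function is its supremum).  Hence the smallest closed subalgebra of \<open>L\<^sup>\<infinity>(\<real>)\<close>
  containing all \<open>e\<^sub>\<lambda>\<close> may be formed inside \<open>real \<Rightarrow>\<^sub>C complex\<close> with its supremum norm.
\<close>

lift_definition ap_exp :: "real \<Rightarrow> real \<Rightarrow>\<^sub>C complex"
  is "\<lambda>l x. exp (\<i> * of_real l * of_real x)"
  by (auto simp: bcontfun_def bounded_iff norm_exp_eq_Re intro!: continuous_intros)

text \<open>Multiplication by the complex scalar \<open>c\<close> is multiplication by the constant function \<open>c\<close>.\<close>

definition complex_subalgebra :: "(real \<Rightarrow>\<^sub>C complex) set \<Rightarrow> bool" where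
  "complex_subalgebra B \<longleftrightarrow> 0 \<in> B \<and>
     (\<forall>a\<in>B. \<forall>b\<in>B. a + b \<in> B \<and> a * b \<in> B) \<and>
     (\<forall>c. \<forall>a\<in>B. const_bcontfun c * a \<in> B)"

definition AP :: "(real \<Rightarrow>\<^sub>C complex) set" where
  "AP = \<Inter>{B. complex_subalgebra B \<and> closed B \<and> range ap_exp \<subseteq> B}"

definition AP0 :: "(real \<Rightarrow>\<^sub>C complex) set" where
  "AP0 = {a. \<exists>(m::nat) r l. a = (\<Sum>j<m. const_bcontfun (r j) * ap_exp (l j))}"

text \<open>For \<open>a \<in> AP\<close> the limit defining the Bohr--Fourier coefficient always exists.\<close>

definition bohr_spectrum :: "(real \<Rightarrow>\<^sub>C complex) \<Rightarrow> real set" where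
  "bohr_spectrum a = {l. \<exists>c. c \<noteq> 0 \<and>
     ((\<lambda>N. (LBINT x:{-N..N}. a x * ap_exp (- l) x) / of_real (2 * N)) \<longlongrightarrow> c) at_top}"

definition AP0_on :: "real set \<Rightarrow> (real \<Rightarrow>\<^sub>C complex) set" where
  "AP0_on S = {a \<in> AP0. bohr_spectrum a \<subseteq> S}"

definition AP_on :: "real set \<Rightarrow> (real \<Rightarrow>\<^sub>C complex) set" where
  "AP_on S = AP \<inter> closure (AP0_on S)"

subsection \<open>The extension to the upper half-plane and the character space\<close>

definition upper_half_plane :: "complex set" where
  "upper_half_plane = {z. 0 < Im z}"

definition poisson_ext :: "(real \<Rightarrow>\<^sub>C complex) \<Rightarrow> complex \<Rightarrow> complex" where
  "poisson_ext a z =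
     (LBINT t. of_real (Im z / (pi * ((Re z - t)\<^sup>2 + (Im z)\<^sup>2))) * a t)"

text \<open>
  Functionals on \<open>AP_on S\<close> are represented by functions that are \<open>undefined\<close> outside
  \<open>AP_on S\<close>, so that equality of functionals is equality on \<open>AP_on S\<close>.  The Gelfand topology is
  that of pointwise convergence on \<open>AP_on S\<close>.
\<close>

definition characters :: "real set \<Rightarrow> ((real \<Rightarrow>\<^sub>C complex) \<Rightarrow> complex) set" where
  "characters S = {\<phi> \<in> extensional (AP_on S).
     (\<forall>a\<in>AP_on S. \<forall>b\<in>AP_on S. \<phi> (a + b) = \<phi> a + \<phi> b \<and> \<phi> (a * b) = \<phi> a * \<phi> b) \<and>
     (\<forall>c. \<forall>a\<in>AP_on S. \<phi> (const_bcontfun c * a) = c * \<phi> a) \<and>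
     (\<exists>a\<in>AP_on S. \<phi> a \<noteq> 0)}"

definition gelfand_topology :: "real set \<Rightarrow> ((real \<Rightarrow>\<^sub>C complex) \<Rightarrow> complex) topology" where
  "gelfand_topology S =
     subtopology (product_topology (\<lambda>_. euclidean) (AP_on S)) (characters S)"

definition eval_character ::
    "real set \<Rightarrow> complex \<Rightarrow> (real \<Rightarrow>\<^sub>C complex) \<Rightarrow> complex" where
  "eval_character S z = (\<lambda>a\<in>AP_on S. poisson_ext a z)"

definition half_plane_dense :: "real set \<Rightarrow> bool" where
  "half_plane_dense S \<longleftrightarrow>
     gelfand_topology S closure_of (eval_character S ` upper_half_plane) = characters S"

end

theory Submission
  imports Defs "HOL-Complex_Analysis.Complex_Analysis"
begin

text \<open>Write \<open>AP\<^sub>S\<close> for the algebra \<open>AP_on S\<close>.  The proof deforms the given matrix to a constant one and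
  uses that nearby left invertible matrices differ by an invertible factor.

  \<^item> \<^emph>\<open>Left invertibility.\<close>  The elements \<open>c\<close> of \<open>AP\<^sub>S\<close> for which \<open>c \<cdot> 1 = L A\<close> has a solution \<open>L\<close> over
  \<open>AP\<^sub>S\<close> form an ideal, and by the adjugate formula it contains every maximal minor of \<open>A\<close>.  If it
  were proper, some character of \<open>AP\<^sub>S\<close> would vanish on all minors (Zorn's lemma and the
  Gelfand--Mazur theorem, \<open>character_vanishing_on_ideal\<close>).  Since point evaluations in the
  half-plane are dense among the characters, all minors would then be simultaneously small at some
  point, against the hypothesis on the infimum.  Hence \<open>L A = 1\<close> for some \<open>L\<close> over \<open>AP\<^sub>S\<close>.

  \<^item> \<^emph>\<open>Deformation.\<close>  Replacing \<open>a(x)\<close> by the value of its bounded holomorphic extension at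
  \<open>x + i t\<close> is, for each \<open>t \<ge> 0\<close>, a contractive homomorphism of \<open>AP\<^sub>S\<close> into itself.  It multiplies
  \<open>e\<^sub>\<lambda>\<close> by \<open>exp (- \<lambda> t)\<close>; because \<open>\<lambda> \<ge> 0\<close>, it depends continuously on \<open>t\<close> and drives every element
  towards a constant as \<open>t\<close> grows.  Applied to the entries of \<open>A\<close> and \<open>L\<close> it gives a path of left
  invertible matrices that starts at \<open>A\<close>, with left inverses that stay bounded.

  \<^item> \<^emph>\<open>Transport.\<close>  If \<open>L C = 1\<close> and \<open>D\<close> is close to \<open>C\<close>, then \<open>G = 1 + (D - C) L\<close> satisfies \<open>G C = D\<close>, and
  its determinant is close to \<open>1\<close>, hence a unit of \<open>AP\<^sub>S\<close>.  So matrices on a connected path of left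
  invertible ones are equivalent under the general linear group (\<open>gl_equiv_path\<close>).  The path above
  leads from \<open>A\<close> to a complex matrix.  A complex left invertible matrix and the first \<open>k\<close> columns of
  the identity span a complex line of matrices, of which all but finitely many are seen to be left
  invertible, and a complex line without finitely many points is connected.  In total \<open>A\<close> consists
  of the first \<open>k\<close> columns of a square matrix whose determinant is a unit; as \<open>k < n\<close>, its last
  column can be rescaled to make the determinant \<open>1\<close>.\<close>

section \<open>Bounded continuous functions as a Banach algebra\<close>

instance bcontfun :: (topological_space, real_normed_field) real_normed_algebra_1
proof
  fix a b :: "'a \<Rightarrow>\<^sub>C 'b" and r :: real
  show "r *\<^sub>R a * b = r *\<^sub>R (a * b)" "a * r *\<^sub>R b = r *\<^sub>R (a * b)"
    by (auto intro!: bcontfun_eqI)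
  show "norm (a * b) \<le> norm a * norm b"
    by (rule norm_bound) (auto simp: norm_mult intro!: mult_mono' norm_bounded)
  show "norm (1 :: 'a \<Rightarrow>\<^sub>C 'b) = 1"
  proof (rule antisym)
    show "norm (1 :: 'a \<Rightarrow>\<^sub>C 'b) \<le> 1" by (rule norm_bound) auto
    show "1 \<le> norm (1 :: 'a \<Rightarrow>\<^sub>C 'b)"
      using norm_bounded[of "1 :: 'a \<Rightarrow>\<^sub>C 'b" undefined] by simp
  qed
qed

instance bcontfun :: (metric_space, "{real_normed_field, banach}") banach ..

lemma norm_const_bcontfun [simp]:
  "norm (const_bcontfun c :: 'a::topological_space \<Rightarrow>\<^sub>C 'b::real_normed_vector) = norm c"
proof (rule antisym)
  show "norm (const_bcontfun c :: 'a \<Rightarrow>\<^sub>C 'b) \<le> norm c" by (rule norm_bound) auto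
  show "norm c \<le> norm (const_bcontfun c :: 'a \<Rightarrow>\<^sub>C 'b)"
    using norm_bounded[of "const_bcontfun c :: 'a \<Rightarrow>\<^sub>C 'b" undefined] by simp
qed

section \<open>Closed subalgebras, ideals and characters\<close>

text \<open>The type \<open>'a\<close> carries only a real scalar multiplication, so the complex scalars enter through the
  isometric embedding \<open>scal\<close>; for bounded continuous functions these are the constant functions.\<close>

locale closed_subalgebra =
  fixes scal :: "complex \<Rightarrow> 'a :: {comm_ring_1, real_normed_algebra_1, banach}"
    and B :: "'a set"
  assumes closed_B: "closed B"
    and scal_in: "scal c \<in> B"
    and add_in: "x \<in> B \<Longrightarrow> y \<in> B \<Longrightarrow> x + y \<in> B"
    and mult_in: "x \<in> B \<Longrightarrow> y \<in> B \<Longrightarrow> x * y \<in> B"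
    and scal_add: "scal (c + d) = scal c + scal d"
    and scal_mult: "scal (c * d) = scal c * scal d"
    and scal_1: "scal 1 = 1"
    and norm_scal: "norm (scal c) = cmod c"
begin

lemma scal_0: "scal 0 = 0"
  using norm_scal[of 0] by simp

lemma scal_uminus: "scal (- c) = - scal c"
  using scal_add[of c "- c"] by (simp add: scal_0 eq_neg_iff_add_eq_0 add.commute)

lemma scal_diff: "scal (c - d) = scal c - scal d"
  using scal_add[of c "- d"] by (simp add: scal_uminus)

lemma scal_power: "scal (c ^ n) = scal c ^ n"
  by (induction n) (simp_all add: scal_1 scal_mult)

lemma scal_sum: "scal (\<Sum>i\<in>I. f i) = (\<Sum>i\<in>I. scal (f i))"
  by (induction I rule: infinite_finite_induct) (simp_all add: scal_0 scal_add)

lemma zero_in: "0 \<in> B" and one_in: "1 \<in> B"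
  using scal_in[of 0] scal_in[of 1] by (simp_all add: scal_0 scal_1)

lemma uminus_in: "x \<in> B \<Longrightarrow> - x \<in> B"
  using mult_in[OF scal_in[of "-1"], of x] by (simp add: scal_uminus scal_1)

lemma diff_in: "x \<in> B \<Longrightarrow> y \<in> B \<Longrightarrow> x - y \<in> B"
  using add_in[OF _ uminus_in, of x y] by simp

lemma power_in: "x \<in> B \<Longrightarrow> x ^ n \<in> B"
  by (induction n) (auto intro: one_in mult_in)

lemma sum_in: "(\<And>i. i \<in> I \<Longrightarrow> f i \<in> B) \<Longrightarrow> (\<Sum>i\<in>I. f i) \<in> B"
  by (induction I rule: infinite_finite_induct) (auto intro: zero_in add_in)

lemma prod_in: "(\<And>i. i \<in> I \<Longrightarrow> f i \<in> B) \<Longrightarrow> (\<Prod>i\<in>I. f i) \<in> B"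
  by (induction I rule: infinite_finite_induct) (auto intro: one_in mult_in)

lemmas alg_in = scal_in add_in mult_in zero_in one_in uminus_in diff_in power_in sum_in prod_in

text \<open>The Neumann series of \<open>1 - d\<close> stays in \<open>B\<close> because \<open>B\<close> is closed.\<close>

lemma unit_near_one:
  assumes "d \<in> B" "norm (1 - d) < 1"
  obtains u where "u \<in> B" "d * u = 1"
proof
  let ?x = "1 - d"
  have s: "summable (\<lambda>n. ?x ^ n)"
    using assms(2) by (rule complete_algebra_summable_geometric)
  have "(\<lambda>n. (\<Sum>i<n. ?x ^ i)) \<longlonglongrightarrow> suminf (\<lambda>n. ?x ^ n)"
    using s by (rule summable_LIMSEQ)
  then show "suminf (\<lambda>n. ?x ^ n) \<in> B"
    by (rule closed_sequentially[OF closed_B, rotated]) (intro alg_in assms(1))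
  have "(\<lambda>n. (1 - ?x) * (\<Sum>i<n. ?x ^ i)) \<longlonglongrightarrow> (1 - ?x) * suminf (\<lambda>n. ?x ^ n)"
    by (intro tendsto_intros summable_LIMSEQ s)
  then have 1: "(\<lambda>n. 1 - ?x ^ n) \<longlonglongrightarrow> (1 - ?x) * suminf (\<lambda>n. ?x ^ n)"
    by (simp only: one_diff_power_eq)
  have 2: "(\<lambda>n. 1 - ?x ^ n) \<longlonglongrightarrow> 1 - 0"
    by (intro tendsto_intros LIMSEQ_power_zero assms(2))
  show "d * suminf (\<lambda>n. ?x ^ n) = 1"
    using LIMSEQ_unique[OF 1 2] by simp
qed

definition ideal :: "'a set \<Rightarrow> bool" where
  "ideal I \<longleftrightarrow> I \<subseteq> B \<and> 0 \<in> I \<and> (\<forall>x\<in>I. \<forall>y\<in>I. x + y \<in> I) \<and> (\<forall>b\<in>B. \<forall>x\<in>I. b * x \<in> I)"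

definition maximal_ideal :: "'a set \<Rightarrow> bool" where
  "maximal_ideal M \<longleftrightarrow> ideal M \<and> 1 \<notin> M \<and> (\<forall>J. ideal J \<and> M \<subseteq> J \<and> 1 \<notin> J \<longrightarrow> J = M)"

lemma exists_maximal_ideal:
  assumes "ideal I" "1 \<notin> I"
  obtains M where "maximal_ideal M" "I \<subseteq> M"
proof -
  let ?P = "{J. ideal J \<and> I \<subseteq> J \<and> 1 \<notin> J}"
  have "\<exists>M\<in>?P. \<forall>X\<in>?P. M \<subseteq> X \<longrightarrow> X = M"
  proof (rule subset_Zorn_nonempty)
    show "?P \<noteq> {}" using assms by blast
    fix C assume C: "C \<noteq> {}" "subset.chain ?P C"
    have sub: "\<And>J. J \<in> C \<Longrightarrow> ideal J \<and> I \<subseteq> J \<and> 1 \<notin> J"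
      using C(2) by (auto simp: subset_chain_def)
    have subB: "J \<subseteq> B" "0 \<in> J" if "J \<in> C" for J
      using sub[OF that] by (auto simp: ideal_def)
    have closedJ: "x + y \<in> J" if "J \<in> C" "x \<in> J" "y \<in> J" for J x y
      using sub[OF that(1)] that by (auto simp: ideal_def)
    have multJ: "b * x \<in> J" if "J \<in> C" "x \<in> J" "b \<in> B" for J x b
      using sub[OF that(1)] that by (auto simp: ideal_def)
    have "ideal (\<Union>C)"
      unfolding ideal_def
    proof (intro conjI ballI)
      show "\<Union>C \<subseteq> B" using subB by (intro Union_least)
      show "0 \<in> \<Union>C" using subB C(1) by auto
      show "b * x \<in> \<Union>C" if "b \<in> B" "x \<in> \<Union>C" for b x
        using that multJ by auto
      fix x y assume "x \<in> \<Union>C" "y \<in> \<Union>C"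
      then obtain J K where JK: "J \<in> C" "K \<in> C" "x \<in> J" "y \<in> K" by auto
      then have "J \<subseteq> K \<or> K \<subseteq> J" using C(2) by (auto simp: subset_chain_def)
      then show "x + y \<in> \<Union>C" using JK closedJ[of J x y] closedJ[of K x y] by auto
    qed
    moreover have "I \<subseteq> \<Union>C" using sub C(1) by auto
    moreover have "1 \<notin> \<Union>C" using sub by auto
    ultimately show "\<Union>C \<in> ?P" by simp
  qed
  then obtain M where M: "M \<in> ?P" "\<forall>X\<in>?P. M \<subseteq> X \<longrightarrow> X = M" ..
  show thesis
  proof (rule that)
    show "I \<subseteq> M" using M(1) by simp
    have "J = M" if "ideal J" "M \<subseteq> J" "1 \<notin> J" for J
      using bspec[OF M(2), of J] that M(1) by auto
    then show "maximal_ideal M" using M(1) by (simp add: maximal_ideal_def)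
  qed
qed

lemma ideal_diff: "ideal I \<Longrightarrow> x \<in> I \<Longrightarrow> y \<in> I \<Longrightarrow> x - y \<in> I"
proof -
  assume I: "ideal I" "x \<in> I" "y \<in> I"
  have "(- 1) * y \<in> I" using I uminus_in[OF one_in] unfolding ideal_def by blast
  then have "x + (- 1) * y \<in> I" using I unfolding ideal_def by blast
  then show "x - y \<in> I" by simp
qed

text \<open>Otherwise the ideal generated by \<open>M\<close> and \<open>a\<close> would be a strictly larger proper ideal.\<close>

lemma maximal_ideal_inverse:
  assumes M: "maximal_ideal M" and a: "a \<in> B" "a \<notin> M"
  obtains b where "b \<in> B" "a * b - 1 \<in> M"
proof -
  have idM: "ideal M" "1 \<notin> M" using M by (auto simp: maximal_ideal_def)
  let ?J = "{m + a * b | m b. m \<in> M \<and> b \<in> B}"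
  have "ideal ?J"
    unfolding ideal_def
  proof (intro conjI ballI)
    show "?J \<subseteq> B" using idM a by (auto simp: ideal_def intro!: alg_in)
    have "0 + a * 0 \<in> ?J" using idM zero_in unfolding ideal_def by blast
    then show "0 \<in> ?J" by simp
  next
    fix x y assume "x \<in> ?J" "y \<in> ?J"
    then obtain m b m' b' where "x = m + a * b" "y = m' + a * b'" "m \<in> M" "m' \<in> M" "b \<in> B" "b' \<in> B"
      by blast
    then have "x + y = (m + m') + a * (b + b')" "m + m' \<in> M" "b + b' \<in> B"
      using idM by (auto simp: ideal_def algebra_simps add_in)
    then show "x + y \<in> ?J" by blast
  next
    fix c x assume "c \<in> B" "x \<in> ?J"
    then obtain m b where "x = m + a * b" "m \<in> M" "b \<in> B"
      by blast
    then have "c * x = c * m + a * (c * b)" "c * m \<in> M" "c * b \<in> B"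
      using idM \<open>c \<in> B\<close> by (auto simp: ideal_def algebra_simps mult_in)
    then show "c * x \<in> ?J" by blast
  qed
  moreover have "M \<subseteq> ?J"
  proof
    fix m assume "m \<in> M"
    then have "m + a * 0 \<in> ?J" using zero_in by blast
    then show "m \<in> ?J" by simp
  qed
  moreover have "?J \<noteq> M"
  proof -
    have "0 + a * 1 \<in> ?J" using idM one_in unfolding ideal_def by blast
    then show ?thesis using a by auto
  qed
  ultimately have "1 \<in> ?J" using M unfolding maximal_ideal_def by blast
  then obtain m b where mb: "1 = m + a * b" "m \<in> M" "b \<in> B" by blast
  have "a * b - 1 = 0 - m" using mb(1) by (simp add: algebra_simps)
  then have "a * b - 1 \<in> M"
    using ideal_diff[OF idM(1), of 0 m] mb idM(1) by (simp add: ideal_def)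
  then show thesis using that mb by blast
qed

context
  fixes M assumes M: "maximal_ideal M"
begin

lemma idM: "ideal M" and one_notin: "1 \<notin> M"
  using M by (auto simp: maximal_ideal_def)

lemma M_zero: "0 \<in> M" and M_sub: "M \<subseteq> B" and M_add: "x \<in> M \<Longrightarrow> y \<in> M \<Longrightarrow> x + y \<in> M"
  and M_mult: "b \<in> B \<Longrightarrow> x \<in> M \<Longrightarrow> b * x \<in> M"
  using idM by (auto simp: ideal_def)

lemma M_ne: "M \<noteq> {}" using M_zero by auto

lemma M_diff: "x \<in> M \<Longrightarrow> y \<in> M \<Longrightarrow> x - y \<in> M"
  using ideal_diff idM by blast

lemma M_sum: "(\<And>i. i \<in> I \<Longrightarrow> f i \<in> M) \<Longrightarrow> (\<Sum>i\<in>I. f i) \<in> M"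
  by (induction I rule: infinite_finite_induct) (auto intro: M_zero M_add)

text \<open>The quotient norm of \<open>B\<close> modulo \<open>M\<close>, taken on representatives: computations in the quotient
  algebra are congruences modulo \<open>M\<close>, and \<open>q_cong\<close> says that they do not change \<open>q\<close>.\<close>

definition q :: "'a \<Rightarrow> real" where "q x = infdist x M"

lemma q_nonneg: "0 \<le> q x"
  by (simp add: q_def infdist_nonneg)

lemma q_le: "m \<in> M \<Longrightarrow> q x \<le> norm (x - m)"
  unfolding q_def by (metis infdist_le dist_norm)

lemma q_approx:
  assumes "q x < e" obtains m where "m \<in> M" "norm (x - m) < e"
proof -
  have "(INF m\<in>M. dist x m) < e" using assms M_ne by (simp add: q_def infdist_def)
  then obtain m where "m \<in> M" "dist x m < e"
    using M_ne by (subst (asm) cINF_less_iff) (auto intro: bdd_belowI[of _ 0])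
  then show thesis using that by (simp add: dist_norm)
qed

lemma q_cong:
  assumes "x - y \<in> M" shows "q x = q y"
proof -
  have *: "q x \<le> q y" if "x - y \<in> M" for x y
  proof (rule dense_ge)
    fix e assume "q y < e"
    then obtain m where m: "m \<in> M" "norm (y - m) < e" by (rule q_approx)
    have "q x \<le> norm (x - (m + (x - y)))" using m that by (intro q_le M_add)
    also have "\<dots> = norm (y - m)" by (simp add: algebra_simps)
    finally show "q x \<le> e" using m by simp
  qed
  have "y - x = 0 - (x - y)" by simp
  then have "y - x \<in> M" using M_diff[OF M_zero assms] by simp
  then show ?thesis using *[OF assms] *[of y x] by simp
qed

lemma q_add: "q (x + y) \<le> q x + q y"
proof (rule field_le_epsilon)
  fix e :: real assume e: "0 < e"
  obtain m where m: "m \<in> M" "norm (x - m) < q x + e / 2" by (rule q_approx[of x]) (use e in auto)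
  obtain m' where m': "m' \<in> M" "norm (y - m') < q y + e / 2" by (rule q_approx[of y]) (use e in auto)
  have "q (x + y) \<le> norm ((x + y) - (m + m'))" using m m' by (intro q_le M_add)
  also have "\<dots> \<le> norm (x - m) + norm (y - m')"
    using norm_triangle_ineq[of "x - m" "y - m'"] by (simp add: algebra_simps)
  finally show "q (x + y) \<le> q x + q y + e" using m m' by simp
qed

lemma q_mult:
  assumes "x \<in> B" "y \<in> B" shows "q (x * y) \<le> q x * q y"
proof -
  have *: "q (x * y) \<le> u * v" if uv: "q x < u" "q y < v" for u v
  proof -
    obtain m where m: "m \<in> M" "norm (x - m) < u" by (rule q_approx[OF uv(1)])
    obtain m' where m': "m' \<in> M" "norm (y - m') < v" by (rule q_approx[OF uv(2)])
    have "x * y - (x - m) * (y - m') = x * m' + (y - m') * m" by (simp add: algebra_simps)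
    also have "\<dots> \<in> M" using m m' assms M_sub by (intro M_add M_mult diff_in) auto
    finally have "q (x * y) = q ((x - m) * (y - m'))" by (rule q_cong)
    also have "\<dots> \<le> norm ((x - m) * (y - m'))" using q_le[OF M_zero] by simp
    also have "\<dots> \<le> norm (x - m) * norm (y - m')" by (rule norm_mult_ineq)
    also have "\<dots> \<le> u * v"
      using less_imp_le[OF m(2)] less_imp_le[OF m'(2)] order_trans[OF norm_ge_zero less_imp_le[OF m(2)]]
      by (intro mult_mono norm_ge_zero)
    finally show ?thesis .
  qed
  have "((\<lambda>e. (q x + e) * (q y + e)) \<longlongrightarrow> (q x + 0) * (q y + 0)) (at_right 0)"
    by (intro tendsto_intros)
  moreover have "eventually (\<lambda>e. q (x * y) \<le> (q x + e) * (q y + e)) (at_right 0)"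
    using * by (auto simp: eventually_at_right_field intro!: exI[of _ 1])
  ultimately show ?thesis
    by (metis add_0_right tendsto_lowerbound trivial_limit_at_right_real)
qed

lemma q_scal: "q (scal c * x) \<le> cmod c * q x"
proof (cases "c = 0")
  case True
  then show ?thesis using q_le[OF M_zero, of 0] q_nonneg[of 0] by (simp add: scal_0)
next
  case False
  show ?thesis
  proof (rule dense_ge)
    fix e assume e: "cmod c * q x < e"
    have "q x < e / cmod c" using e False by (simp add: pos_less_divide_eq mult.commute)
    then obtain m where m: "m \<in> M" "norm (x - m) < e / cmod c" by (rule q_approx)
    have "q (scal c * x) \<le> norm (scal c * x - scal c * m)" using m by (intro q_le M_mult scal_in)
    also have "\<dots> = norm (scal c * (x - m))" by (simp add: algebra_simps)
    also have "\<dots> \<le> cmod c * norm (x - m)" by (metis norm_mult_ineq norm_scal)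
    also have "\<dots> \<le> e" using m False by (simp add: pos_less_divide_eq mult.commute)
    finally show "q (scal c * x) \<le> e" .
  qed
qed

text \<open>A smaller value would put an element of \<open>M\<close> at distance less than \<open>1\<close> from the unit, and such an
  element is invertible in \<open>B\<close>.\<close>

lemma q_one: "q 1 = 1"
proof (rule antisym)
  show "q 1 \<le> 1" using q_le[OF M_zero, of 1] by simp
  show "1 \<le> q 1"
  proof (rule ccontr)
    assume "\<not> 1 \<le> q 1"
    then obtain m where m: "m \<in> M" "norm (1 - m) < 1" using q_approx by (metis not_le)
    obtain u where "u \<in> B" "m * u = 1" using unit_near_one m M_sub by blast
    then have "1 \<in> M" using M_mult[of u m] m by (simp add: mult.commute)
    then show False using one_notin by simp
  qed
qed

lemma q_power: "x \<in> B \<Longrightarrow> q (x ^ n) \<le> q x ^ n"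
proof (induction n)
  case (Suc n)
  have "q (x ^ Suc n) \<le> q x * q (x ^ n)" using Suc by (simp add: q_mult power_in)
  also have "\<dots> \<le> q x * q x ^ n" using Suc by (intro mult_left_mono q_nonneg) auto
  finally show ?case by simp
qed (simp add: q_one)

lemma q_sum: "q (\<Sum>i\<in>I. f i) \<le> (\<Sum>i\<in>I. q (f i))"
proof (induction I rule: infinite_finite_induct)
  case (insert x F)
  then show ?case using q_add[of "f x" "sum f F"] by simp
qed (use q_le[OF M_zero, of 0] in auto)

text \<open>For \<open>0 < i < n\<close> the powers form a full geometric sum of a nontrivial root of unity.\<close>

lemma sum_rotated_powers:
  assumes "i < n"
  shows "(\<Sum>j<n. (\<nu> * cis (2 * pi * real j / real n)) ^ i) = (if i = 0 then of_nat n else 0)"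
proof (cases "i = 0")
  case False
  let ?w = "cis (2 * pi * real i / real n)"
  have n: "n > 0" using assms by simp
  have inj: "inj_on (\<lambda>k. cis (2 * pi * real k / real n)) {..<n}"
    using Complex.bij_betw_roots_unity[OF n] by (rule bij_betw_imp_inj_on)
  have "?w \<noteq> cis (2 * pi * real 0 / real n)"
    using inj_onD[OF inj, of i 0] assms False n by blast
  then have w: "?w \<noteq> 1" by simp
  have "?w ^ n = 1" using n by (simp add: Complex.DeMoivre)
  have "(\<Sum>j<n. (\<nu> * cis (2 * pi * real j / real n)) ^ i) = \<nu> ^ i * (\<Sum>j<n. ?w ^ j)"
    by (simp add: power_mult_distrib sum_distrib_left Complex.DeMoivre mult_ac)
  also have "(\<Sum>j<n. ?w ^ j) = 0"
    using w \<open>?w ^ n = 1\<close> by (simp add: geometric_sum)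
  finally show ?thesis using False by simp
qed simp

text \<open>The Gelfand--Mazur theorem.  If no \<open>a - c\<close> lies in \<open>M\<close>, each of them has an inverse \<open>R c\<close> modulo
  \<open>M\<close>.  The function \<open>f c = q (R c)\<close> is positive, continuous and tends to \<open>0\<close> at infinity, so it
  attains a maximum \<open>K\<close>.  Averaging the resolvent over the points \<open>c + \<nu> \<omega>\<close>, with \<open>\<omega>\<close> running through
  the \<open>n\<close>-th roots of unity, reproduces \<open>R c\<close> up to a factor that tends to \<open>1\<close> as \<open>n\<close> grows, as long
  as \<open>\<bar>\<nu>\<bar> f c < 1\<close>.  This submean property forces \<open>f = K\<close> on the disc of radius \<open>1 / K\<close> around each
  point where \<open>f = K\<close>; walking along a line in steps of length \<open>1 / (2 K)\<close> contradicts the decay at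
  infinity.\<close>

lemma quotient_is_complex:
  assumes a: "a \<in> B"
  shows "\<exists>c. a - scal c \<in> M"
proof (rule ccontr)
  assume no: "\<not> ?thesis"
  have "\<forall>c. \<exists>r. r \<in> B \<and> (a - scal c) * r - 1 \<in> M"
    using maximal_ideal_inverse[OF M, of "a - scal _"] no a
    by (metis diff_in scal_in)
  then obtain R where R: "\<And>c. R c \<in> B" "\<And>c. (a - scal c) * R c - 1 \<in> M" by metis
  define f where "f = (\<lambda>c. q (R c))"
  have f_nonneg: "f c \<ge> 0" for c by (simp add: f_def q_nonneg)
  have f_pos: "f c > 0" for c
  proof (rule ccontr)
    assume "\<not> f c > 0"
    then have "f c = 0" using f_nonneg[of c] by simp
    moreover have "1 = q ((a - scal c) * R c)" using q_cong[OF R(2)] q_one by simp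
    moreover have "\<dots> \<le> q (a - scal c) * f c" unfolding f_def using R a by (intro q_mult alg_in)
    ultimately show False by simp
  qed
  have resolvent: "R \<mu> - R c - scal (\<mu> - c) * R c * R \<mu> \<in> M" for \<mu> c
  proof -
    have "R \<mu> - R c - scal (\<mu> - c) * R c * R \<mu>
        = R c * ((a - scal \<mu>) * R \<mu> - 1) - R \<mu> * ((a - scal c) * R c - 1)"
      by (simp add: scal_diff algebra_simps)
    also have "\<dots> \<in> M" by (rule M_diff[OF M_mult[OF R(1) R(2)] M_mult[OF R(1) R(2)]])
    finally show ?thesis .
  qed
  have f_diff: "\<bar>f \<mu> - f c\<bar> \<le> cmod (\<mu> - c) * (f c * f \<mu>)" for \<mu> c
  proof -
    have *: "f \<mu> - f c \<le> cmod (\<mu> - c) * (f c * f \<mu>)" for \<mu> c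
    proof -
      have "q (R \<mu>) = q (R c + scal (\<mu> - c) * (R c * R \<mu>))"
        using resolvent[of \<mu> c] by (intro q_cong) (simp add: algebra_simps)
      also have "\<dots> \<le> q (R c) + cmod (\<mu> - c) * q (R c * R \<mu>)"
        using q_add[of "R c" "scal (\<mu> - c) * (R c * R \<mu>)"] q_scal[of "\<mu> - c" "R c * R \<mu>"] by simp
      also have "\<dots> \<le> q (R c) + cmod (\<mu> - c) * (q (R c) * q (R \<mu>))"
        using R by (intro add_left_mono mult_left_mono q_mult) auto
      finally show ?thesis by (simp add: f_def)
    qed
    show ?thesis using *[of \<mu> c] *[of c \<mu>] by (simp add: norm_minus_commute mult.commute)
  qed
  have f_cont: "isCont f c" for c
  proof -
    have ev: "eventually (\<lambda>\<mu>. cmod (\<mu> - c) < 1 / (2 * f c)) (at c)"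
      using f_pos[of c] unfolding eventually_at by (intro exI[of _ "1 / (2 * f c)"]) (auto simp: dist_norm)
    have "((\<lambda>\<mu>. f \<mu> - f c) \<longlongrightarrow> 0) (at c)"
    proof (rule Lim_null_comparison)
      show "eventually (\<lambda>\<mu>. norm (f \<mu> - f c) \<le> cmod (\<mu> - c) * (f c * (2 * f c))) (at c)"
        using ev
      proof eventually_elim
        case (elim \<mu>)
        have "cmod (\<mu> - c) * f c \<le> 1 / 2" using elim f_pos[of c] by (simp add: field_simps)
        then have "(cmod (\<mu> - c) * f c) * f \<mu> \<le> 1 / 2 * f \<mu>" by (intro mult_right_mono f_nonneg)
        then have "f \<mu> \<le> 2 * f c" using f_diff[of \<mu> c] by (simp add: mult.assoc)
        then have "cmod (\<mu> - c) * (f c * f \<mu>) \<le> cmod (\<mu> - c) * (f c * (2 * f c))"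
          by (intro mult_left_mono f_nonneg) auto
        then show ?case using f_diff[of \<mu> c] by simp
      qed
      have "((\<lambda>\<mu>. cmod (\<mu> - c) * (f c * (2 * f c))) \<longlongrightarrow> cmod (c - c) * (f c * (2 * f c))) (at c)"
        by (intro tendsto_intros)
      then show "((\<lambda>\<mu>. cmod (\<mu> - c) * (f c * (2 * f c))) \<longlongrightarrow> 0) (at c)" by simp
    qed
    then show ?thesis by (simp add: isCont_def LIM_zero_iff)
  qed
  have f_decay: "f c * (cmod c - q a) \<le> 1" for c
  proof (cases "c = 0")
    case True
    then show ?thesis using f_nonneg[of c] q_nonneg[of a]
      by (smt (verit) mult_nonneg_nonneg mult_minus_right norm_zero)
  next
    case False
    have "scal c * R c - (a * R c - 1) = 0 - ((a - scal c) * R c - 1)"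
      by (simp add: algebra_simps)
    also have "\<dots> \<in> M" by (rule M_diff[OF M_zero R(2)])
    finally have "q (scal c * R c) = q (a * R c - 1)" by (rule q_cong)
    also have "\<dots> \<le> q (a * R c) + q (scal (- 1) * 1)"
      using q_add[of "a * R c" "- 1"] by (simp add: scal_uminus scal_1)
    also have "\<dots> \<le> q a * f c + 1"
      using q_mult[OF a R(1)[of c]] q_scal[of "-1" 1] q_one by (simp add: f_def)
    finally have *: "q (scal c * R c) \<le> q a * f c + 1" .
    have "f c = q (scal (1 / c) * (scal c * R c))"
      using False by (simp add: f_def mult.assoc[symmetric] scal_mult[symmetric] scal_1)
    also have "\<dots> \<le> cmod (1 / c) * q (scal c * R c)" by (rule q_scal)
    finally have "cmod c * f c \<le> q (scal c * R c)"
      using False by (simp add: norm_divide field_simps)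
    then show ?thesis using * by (simp add: algebra_simps)
  qed
  obtain z where z: "\<And>c. f c \<le> f z"
  proof -
    let ?r = "q a + 1 / f 0"
    have r: "?r > 0" using f_pos[of 0] q_nonneg[of a] by (simp add: add_nonneg_pos)
    have "\<exists>z\<in>cball 0 ?r. \<forall>c\<in>cball 0 ?r. f c \<le> f z"
      using r f_cont
      by (intro continuous_attains_sup compact_cball continuous_at_imp_continuous_on) auto
    then obtain z where "\<forall>c\<in>cball 0 ?r. f c \<le> f z" by blast
    then have z: "f c \<le> f z" if "cmod c \<le> ?r" for c using that by simp
    have "f c \<le> f z" for c
    proof (cases "cmod c \<le> ?r")
      case False
      have "f c * (1 / f 0) \<le> f c * (cmod c - q a)"
        using False by (intro mult_left_mono f_nonneg) auto
      then have "f c * (1 / f 0) \<le> 1" using f_decay[of c] by simp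
      then have "f c \<le> f 0" using f_pos[of 0] by (simp add: field_simps)
      then show ?thesis using z[of 0] r by simp
    qed (rule z)
    then show thesis by (rule that)
  qed
  define K where "K = f z"
  have K: "\<And>c. f c \<le> K" "K > 0" using z f_pos by (auto simp: K_def)
  have average: "real n * K \<le> (\<Sum>j<n. f (c + \<nu> * cis (2 * pi * real j / real n))) * (1 + (cmod \<nu> * K) ^ n)"
    if c: "f c = K" and n: "n > 0" for c \<nu> n
  proof -
    define b where "b = R c"
    define \<omega> where "\<omega> = (\<lambda>j. \<nu> * cis (2 * pi * real j / real n))"
    define W where "W = (\<lambda>j. R (c + \<omega> j))"
    have bW: "b \<in> B" "\<And>j. W j \<in> B" by (auto simp: b_def W_def R)
    have \<omega>n: "\<omega> j ^ n = \<nu> ^ n" for j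
      using n by (simp add: \<omega>_def power_mult_distrib Complex.DeMoivre cis_multiple_2pi)
    \<comment> \<open>The resolvent identity says \<open>W j (1 - \<omega>\<^sub>j b) \<equiv> b\<close>; multiply by the geometric sum of \<open>\<omega>\<^sub>j b\<close> and
      use \<open>\<omega>\<^sub>j ^ n = \<nu> ^ n\<close>, which is the same for all \<open>j\<close>.\<close>
    have 1: "W j * (1 - scal (\<nu> ^ n) * b ^ n) - b * (\<Sum>i<n. scal (\<omega> j ^ i) * b ^ i) \<in> M" for j
    proof -
      let ?x = "scal (\<omega> j) * b" and ?S = "\<Sum>i<n. (scal (\<omega> j) * b) ^ i"
      have "?S * (W j - b - scal (\<omega> j) * b * W j) \<in> M"
        using resolvent[of "c + \<omega> j" c] bW by (intro M_mult alg_in) (auto simp: b_def W_def)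
      moreover have "?S * (W j - b - scal (\<omega> j) * b * W j) = W j * ((1 - ?x) * ?S) - b * ?S"
        by (simp add: algebra_simps)
      moreover have "(1 - ?x) * ?S = 1 - ?x ^ n" by (simp add: one_diff_power_eq)
      ultimately show ?thesis by (simp add: power_mult_distrib scal_power[symmetric] \<omega>n)
    qed
    have "(\<Sum>j<n. W j * (1 - scal (\<nu> ^ n) * b ^ n) - b * (\<Sum>i<n. scal (\<omega> j ^ i) * b ^ i)) \<in> M"
      using 1 by (intro M_sum)
    moreover have "(\<Sum>j<n. b * (\<Sum>i<n. scal (\<omega> j ^ i) * b ^ i)) = scal (of_nat n) * b"
    proof -
      have "(\<Sum>j<n. \<Sum>i<n. scal (\<omega> j ^ i) * b ^ i) = (\<Sum>i<n. scal (\<Sum>j<n. \<omega> j ^ i) * b ^ i)"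
        by (subst sum.swap) (simp add: scal_sum sum_distrib_right)
      also have "\<dots> = (\<Sum>i<n. if i = 0 then scal (of_nat n) else 0)"
        by (intro sum.cong) (auto simp: \<omega>_def sum_rotated_powers scal_0)
      also have "\<dots> = scal (of_nat n)" using n by (simp add: sum.delta)
      finally show ?thesis by (simp add: sum_distrib_left[symmetric] mult.commute)
    qed
    ultimately have "(\<Sum>j<n. W j) * (1 - scal (\<nu> ^ n) * b ^ n) - scal (of_nat n) * b \<in> M"
      by (simp add: sum_subtractf sum_distrib_right)
    then have 2: "q (scal (of_nat n) * b) = q ((\<Sum>j<n. W j) * (1 - scal (\<nu> ^ n) * b ^ n))"
      using q_cong by metis
    have "b = scal (1 / of_nat n) * (scal (of_nat n) * b)"
      using n by (simp add: mult.assoc[symmetric] scal_mult[symmetric] scal_1)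
    then have "K \<le> cmod (1 / of_nat n) * q (scal (of_nat n) * b)"
      using q_scal[of "1 / of_nat n" "scal (of_nat n) * b"] c by (simp add: f_def b_def)
    then have "real n * K \<le> q (scal (of_nat n) * b)"
      using n by (simp add: norm_divide field_simps)
    also have "\<dots> \<le> q (\<Sum>j<n. W j) * q (1 - scal (\<nu> ^ n) * b ^ n)"
      unfolding 2 using bW by (intro q_mult alg_in)
    also have "\<dots> \<le> (\<Sum>j<n. f (c + \<omega> j)) * (1 + (cmod \<nu> * K) ^ n)"
    proof (rule mult_mono)
      show "q (\<Sum>j<n. W j) \<le> (\<Sum>j<n. f (c + \<omega> j))" unfolding f_def W_def by (rule q_sum)
      have "q (1 - scal (\<nu> ^ n) * b ^ n) \<le> q 1 + q (scal (- (\<nu> ^ n)) * b ^ n)"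
        using q_add[of 1 "- (scal (\<nu> ^ n) * b ^ n)"] by (simp add: scal_uminus)
      also have "\<dots> \<le> 1 + cmod \<nu> ^ n * q (b ^ n)"
        using q_scal[of "- (\<nu> ^ n)" "b ^ n"] by (simp add: q_one norm_power)
      also have "\<dots> \<le> 1 + cmod \<nu> ^ n * q b ^ n"
        using q_power[OF bW(1)] by (intro add_left_mono mult_left_mono) auto
      finally show "q (1 - scal (\<nu> ^ n) * b ^ n) \<le> 1 + (cmod \<nu> * K) ^ n"
        using c by (simp add: b_def f_def power_mult_distrib)
    qed (auto intro: sum_nonneg f_nonneg q_nonneg)
    finally show ?thesis by (simp add: \<omega>_def)
  qed
  have propagate: "f (c + \<nu>) = K" if c: "f c = K" and \<nu>: "cmod \<nu> * K < 1" for c \<nu>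
  proof (rule ccontr)
    assume "f (c + \<nu>) \<noteq> K"
    then have lt: "f (c + \<nu>) < K" using K(1)[of "c + \<nu>"] by simp
    define \<delta> where "\<delta> = (K - f (c + \<nu>)) / 2"
    have \<delta>: "\<delta> > 0" "f (c + \<nu>) < K - \<delta>" using lt by (auto simp: \<delta>_def field_simps)
    have "((\<lambda>t. f (c + \<nu> * cis t)) \<longlongrightarrow> f (c + \<nu> * cis 0)) (at 0)"
      by (intro isCont_tendsto_compose[OF f_cont] tendsto_intros)
    then have "eventually (\<lambda>t. f (c + \<nu> * cis t) < K - \<delta>) (at 0)"
      using \<delta> by (intro order_tendstoD(2)) auto
    then obtain \<eta> where \<eta>: "\<eta> > 0" "\<And>t. t \<noteq> 0 \<Longrightarrow> \<bar>t\<bar> < \<eta> \<Longrightarrow> f (c + \<nu> * cis t) < K - \<delta>"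
      unfolding eventually_at by (auto simp: dist_norm)
    have \<eta>': "f (c + \<nu> * cis t) < K - \<delta>" if "\<bar>t\<bar> < \<eta>" for t
      using \<eta>(2)[of t] that \<delta> by (cases "t = 0") auto
    obtain N where N: "2 * pi / \<eta> < real N" using reals_Archimedean2 by blast
    then have N0: "N > 0" using \<eta>(1) by (cases N) (auto simp: divide_less_0_iff)
    have N': "2 * pi / real N < \<eta>" using N N0 \<eta>(1) by (simp add: field_simps)
    \<comment> \<open>Among the \<open>N m\<close> roots of unity, the first \<open>m\<close> have argument below \<open>2 \<pi> / N < \<eta>\<close>, and at these
      points \<open>f\<close> stays below \<open>K - \<delta>\<close>: a fixed proportion of the average is strictly too small.\<close>
    have bound: "real N * K \<le> (real N * K - \<delta>) * (1 + ((cmod \<nu> * K) ^ N) ^ m)" if m: "m > 0" for m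
    proof -
      define n where "n = N * m"
      have n: "n > 0" "m \<le> n" using N0 m by (auto simp: n_def)
      let ?g = "\<lambda>j. f (c + \<nu> * cis (2 * pi * real j / real n))"
      have small: "?g j \<le> K - \<delta>" if "j < m" for j
      proof -
        have "2 * pi * real j / real n \<le> 2 * pi * real m / real n"
          using that by (intro divide_right_mono mult_left_mono) auto
        also have "\<dots> = 2 * pi / real N" using m by (simp add: n_def)
        finally have "2 * pi * real j / real n < \<eta>" using N' by simp
        then show ?thesis using \<eta>'[of "2 * pi * real j / real n"] by simp
      qed
      have "(\<Sum>j<n. ?g j) \<le> (\<Sum>j<n. K - (if j < m then \<delta> else 0))"
        using small K(1) by (intro sum_mono) auto
      also have "\<dots> = real n * K - real m * \<delta>"
        using n by (simp add: sum_subtractf sum.If_cases Int_absorb1 subset_eq lessThan_def[symmetric])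
      finally have "real n * K \<le> (real n * K - real m * \<delta>) * (1 + (cmod \<nu> * K) ^ n)"
        using average[OF c n(1), of \<nu>] K(2)
        by (smt (verit, best) mult_right_mono mult_nonneg_nonneg norm_ge_zero zero_le_power)
      then have "real m * (real N * K) \<le> real m * ((real N * K - \<delta>) * (1 + (cmod \<nu> * K) ^ n))"
        by (simp add: n_def algebra_simps)
      then show ?thesis using m by (simp add: n_def power_mult)
    qed
    have "(\<lambda>m. (real N * K - \<delta>) * (1 + ((cmod \<nu> * K) ^ N) ^ m)) \<longlonglongrightarrow> (real N * K - \<delta>) * (1 + 0)"
      using \<nu> K(2) N0
      by (intro tendsto_intros LIMSEQ_power_zero) (auto simp: power_less_one_iff abs_mult)
    then have "real N * K \<le> (real N * K - \<delta>) * (1 + 0)"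
      using bound by (intro tendsto_lowerbound[where F = sequentially]) (auto simp: eventually_sequentially intro!: exI[of _ 1])
    then show False using \<delta> by simp
  qed
  have all: "f (z + of_nat n * of_real (1 / (2 * K))) = K" for n
  proof (induction n)
    case (Suc n)
    have "f ((z + of_nat n * of_real (1 / (2 * K))) + of_real (1 / (2 * K))) = K"
      by (rule propagate[OF Suc]) (use K(2) in \<open>simp add: norm_divide norm_mult\<close>)
    then show ?case by (simp add: algebra_simps add_divide_distrib)
  qed (simp add: K_def)
  obtain n :: nat where n: "2 * K * (cmod z + q a + 1 / K) < real n" using reals_Archimedean2 by blast
  let ?c = "z + of_nat n * of_real (1 / (2 * K))"
  have "cmod (of_nat n * of_real (1 / (2 * K))) = real n / (2 * K)"
    using K(2) by (simp add: norm_mult norm_divide)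
  then have "cmod ?c \<ge> real n / (2 * K) - cmod z"
    by (metis norm_diff_ineq add.commute)
  moreover have "real n / (2 * K) > cmod z + q a + 1 / K" using n K(2) by (simp add: field_simps)
  ultimately have "cmod ?c - q a > 1 / K" by simp
  then have "K * (cmod ?c - q a) > 1" using K(2) by (simp add: field_simps)
  then show False using f_decay[of ?c] all[of n] by simp
qed

end

text \<open>Modulo a maximal ideal containing \<open>I\<close> every element is congruent to exactly one scalar, which is
  the value of the character.\<close>

theorem character_vanishing_on_ideal:
  assumes I: "ideal I" "1 \<notin> I"
  obtains \<phi> where "\<phi> \<in> extensional B" "\<And>a. a \<in> I \<Longrightarrow> \<phi> a = 0" "\<phi> 1 = 1"
    "\<And>a b. a \<in> B \<Longrightarrow> b \<in> B \<Longrightarrow> \<phi> (a + b) = \<phi> a + \<phi> b"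
    "\<And>a b. a \<in> B \<Longrightarrow> b \<in> B \<Longrightarrow> \<phi> (a * b) = \<phi> a * \<phi> b"
    "\<And>c a. a \<in> B \<Longrightarrow> \<phi> (scal c * a) = c * \<phi> a"
proof -
  obtain M where M: "maximal_ideal M" "I \<subseteq> M" using exists_maximal_ideal I by blast
  have uniq: "c = d" if "a - scal c \<in> M" "a - scal d \<in> M" for a c d
  proof (rule ccontr)
    assume "c \<noteq> d"
    have "(a - scal c) - (a - scal d) \<in> M" using that M_diff[OF M(1)] by blast
    then have "scal (1 / (d - c)) * scal (d - c) \<in> M"
      using M_mult[OF M(1)] scal_in by (simp add: scal_diff)
    then show False using \<open>c \<noteq> d\<close> one_notin[OF M(1)] by (simp add: scal_mult[symmetric] scal_1)
  qed
  define \<phi> where "\<phi> = (\<lambda>a\<in>B. THE c. a - scal c \<in> M)"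
  have \<phi>: "a - scal (\<phi> a) \<in> M" if "a \<in> B" for a
    using quotient_is_complex[OF M(1) that] uniq that unfolding \<phi>_def
    by simp (metis (mono_tags, lifting) theI)
  have \<phi>_eqI: "\<phi> a = c" if "a \<in> B" "a - scal c \<in> M" for a c
    using \<phi>[OF that(1)] that(2) uniq by blast
  show thesis
  proof
    show "\<phi> \<in> extensional B" by (simp add: \<phi>_def)
    show "\<phi> a = 0" if "a \<in> I" for a
      using that M M_sub[OF M(1)] by (intro \<phi>_eqI) (auto simp: scal_0)
    show "\<phi> 1 = 1" by (rule \<phi>_eqI) (auto simp: scal_1 one_in M_zero[OF M(1)])
    fix a b assume ab: "a \<in> B" "b \<in> B"
    have "(a + b) - scal (\<phi> a + \<phi> b) = (a - scal (\<phi> a)) + (b - scal (\<phi> b))"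
      by (simp add: scal_add)
    also have "\<dots> \<in> M" using ab \<phi> M_add[OF M(1)] by blast
    finally show "\<phi> (a + b) = \<phi> a + \<phi> b" using ab by (intro \<phi>_eqI add_in)
    have "a * b - scal (\<phi> a * \<phi> b) = b * (a - scal (\<phi> a)) + scal (\<phi> a) * (b - scal (\<phi> b))"
      by (simp add: scal_mult algebra_simps)
    also have "\<dots> \<in> M" using ab \<phi> by (intro M_add[OF M(1)] M_mult[OF M(1)] scal_in) auto
    finally show "\<phi> (a * b) = \<phi> a * \<phi> b" using ab by (intro \<phi>_eqI mult_in)
  next
    fix c a assume a: "a \<in> B"
    have "scal c * a - scal (c * \<phi> a) = scal c * (a - scal (\<phi> a))"
      by (simp add: scal_mult algebra_simps)
    also have "\<dots> \<in> M" using a \<phi> by (intro M_mult[OF M(1)] scal_in) auto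
    finally show "\<phi> (scal c * a) = c * \<phi> a" using a by (intro \<phi>_eqI alg_in)
  qed
qed

end

section \<open>Matrices over a closed subalgebra\<close>

lemma mult_mat_entry:
  assumes "A \<in> carrier_mat n m" "C \<in> carrier_mat m k" "i < n" "j < k"
  shows "(A * C) $$ (i, j) = (\<Sum>l<m. A $$ (i, l) * C $$ (l, j))"
  using assms by (auto simp: scalar_prod_def lessThan_atLeast0 intro!: sum.cong)

lemma mat_entries_bounded:
  fixes L :: "'a :: real_normed_vector mat"
  obtains K where "\<And>i j. i < k \<Longrightarrow> j < n \<Longrightarrow> norm (L $$ (i, j)) \<le> K"
proof -
  let ?K = "\<Sum>i<k. \<Sum>j<n. norm (L $$ (i, j))"
  have "norm (L $$ (i, j)) \<le> ?K" if "i < k" "j < n" for i j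
  proof -
    have "norm (L $$ (i, j)) \<le> (\<Sum>j<n. norm (L $$ (i, j)))"
      using that by (intro member_le_sum) auto
    also have "\<dots> \<le> ?K"
      using that by (intro member_le_sum[where f = "\<lambda>i. \<Sum>j<n. norm (L $$ (i, j))"]) (auto intro: sum_nonneg)
    finally show ?thesis .
  qed
  then show thesis by (rule that)
qed

lemma tendsto_det_one:
  fixes X :: "'b \<Rightarrow> 'a :: {comm_ring_1, real_normed_algebra_1} mat"
  assumes X: "eventually (\<lambda>t. X t \<in> carrier_mat n n) F"
    and lim: "\<And>i j. i < n \<Longrightarrow> j < n \<Longrightarrow> ((\<lambda>t. X t $$ (i, j)) \<longlongrightarrow> 1\<^sub>m n $$ (i, j)) F"
  shows "((\<lambda>t. Determinant.det (X t)) \<longlongrightarrow> 1) F"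
proof -
  let ?P = "{p. p permutes {0..<n}}"
  let ?d = "\<lambda>Y :: 'a mat. \<Sum>p\<in>?P. signof p * (\<Prod>i = 0..<n. Y $$ (i, p i))"
  have "((\<lambda>t. ?d (X t)) \<longlongrightarrow> ?d (1\<^sub>m n)) F"
  proof (intro tendsto_sum tendsto_mult tendsto_const tendsto_prod lim)
    fix p i assume "p \<in> ?P" "i \<in> {0..<n}"
    then show "i < n" "p i < n" using permutes_in_image[of p "{0..<n}" i] by auto
  qed
  moreover have "?d (1\<^sub>m n) = 1" using det_def'[of "1\<^sub>m n :: 'a mat" n] by simp
  ultimately have lim_d: "((\<lambda>t. ?d (X t)) \<longlongrightarrow> 1) F" by (simp only:)
  have "eventually (\<lambda>t. ?d (X t) = Determinant.det (X t)) F"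
    using X by eventually_elim (simp add: det_def')
  then show ?thesis by (rule Lim_transform_eventually[OF lim_d])
qed

text \<open>The first \<open>k\<close> columns of the identity matrix of size \<open>n\<close>.\<close>

definition std_frame :: "nat \<Rightarrow> nat \<Rightarrow> 'a :: comm_ring_1 mat" where
  "std_frame n k = Matrix.mat n k (\<lambda>(i, j). if i = j then 1 else 0)"

lemma std_frame_carrier [simp]: "std_frame n k \<in> carrier_mat n k"
  by (simp add: std_frame_def)

lemma mult_std_frame:
  assumes "G \<in> carrier_mat m n" "k \<le> n" "i < m" "j < k"
  shows "(G * std_frame n k) $$ (i, j) = G $$ (i, j)"
proof -
  have "(G * std_frame n k) $$ (i, j) = (\<Sum>l<n. G $$ (i, l) * (std_frame n k) $$ (l, j))"
    using assms by (intro mult_mat_entry[of _ m _ _ k]) auto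
  also have "\<dots> = (\<Sum>l<n. if l = j then G $$ (i, j) else 0)"
    using assms by (intro sum.cong) (auto simp: std_frame_def)
  also have "\<dots> = G $$ (i, j)" using assms by (simp add: sum.delta)
  finally show ?thesis .
qed

context closed_subalgebra
begin

definition mats :: "nat \<Rightarrow> nat \<Rightarrow> 'a mat set" where
  "mats n m = {A \<in> carrier_mat n m. \<forall>i<n. \<forall>j<m. A $$ (i, j) \<in> B}"

lemma matsI: "A \<in> carrier_mat n m \<Longrightarrow> (\<And>i j. i < n \<Longrightarrow> j < m \<Longrightarrow> A $$ (i, j) \<in> B) \<Longrightarrow> A \<in> mats n m"
  by (simp add: mats_def)

lemma mats_carrier: "A \<in> mats n m \<Longrightarrow> A \<in> carrier_mat n m"
  and mats_entry: "A \<in> mats n m \<Longrightarrow> i < n \<Longrightarrow> j < m \<Longrightarrow> A $$ (i, j) \<in> B"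
  by (simp_all add: mats_def)

lemma mats_mult:
  assumes "A \<in> mats n m" "C \<in> mats m k" shows "A * C \<in> mats n k"
proof (rule matsI)
  note c = mats_carrier[OF assms(1)] mats_carrier[OF assms(2)]
  show "A * C \<in> carrier_mat n k" using c by simp
  show "(A * C) $$ (i, j) \<in> B" if "i < n" "j < k" for i j
    unfolding mult_mat_entry[OF c that] using that assms
    by (intro sum_in mult_in) (auto intro: mats_entry)
qed

lemma mats_add: "A \<in> mats n m \<Longrightarrow> C \<in> mats n m \<Longrightarrow> A + C \<in> mats n m"
  and mats_diff: "A \<in> mats n m \<Longrightarrow> C \<in> mats n m \<Longrightarrow> A - C \<in> mats n m"
  and mats_smult: "b \<in> B \<Longrightarrow> A \<in> mats n m \<Longrightarrow> b \<cdot>\<^sub>m A \<in> mats n m"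
  and mats_one: "1\<^sub>m n \<in> mats n n"
  by (auto simp: mats_def alg_in)

lemma det_in:
  assumes "A \<in> mats n n" shows "Determinant.det A \<in> B"
  unfolding det_def'[OF mats_carrier[OF assms]]
proof (intro sum_in mult_in prod_in)
  fix p assume p: "p \<in> {p. p permutes {0..<n}}"
  show "signof p \<in> B" by (simp add: sign_def alg_in)
  show "A $$ (i, p i) \<in> B" if "i \<in> {0..<n}" for i
    using that p permutes_in_image[of p "{0..<n}" i] by (intro mats_entry[OF assms]) auto
qed

lemma mats_adj:
  assumes "A \<in> mats n n" shows "adj_mat A \<in> mats n n"
proof (rule matsI)
  note c = mats_carrier[OF assms]
  show "adj_mat A \<in> carrier_mat n n" using adj_mat(1)[OF c] .
  fix i j assume ij: "i < n" "j < n"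
  have "mat_delete A j i \<in> mats (n - 1) (n - 1)"
    using c ij by (intro matsI) (auto simp: mat_delete_def intro!: mats_entry[OF assms])
  then have "Determinant.det (mat_delete A j i) \<in> B" by (rule det_in)
  moreover have "(- 1) ^ (j + i) \<in> B" by (intro alg_in)
  ultimately show "adj_mat A $$ (i, j) \<in> B"
    using c ij by (simp add: adj_mat_def cofactor_def mult_in)
qed

text \<open>Equivalence under left multiplication by the general linear group over \<open>B\<close>; the inverse of the
  determinant is required to lie in \<open>B\<close> and not only in the ambient algebra.\<close>

definition gl_equiv :: "nat \<Rightarrow> 'a mat \<Rightarrow> 'a mat \<Rightarrow> bool" where
  "gl_equiv n A C \<longleftrightarrow> (\<exists>G\<in>mats n n. \<exists>u\<in>B. Determinant.det G * u = 1 \<and> C = G * A)"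

lemma gl_equiv_refl: "A \<in> mats n k \<Longrightarrow> gl_equiv n A A"
  unfolding gl_equiv_def using mats_one one_in left_mult_one_mat[OF mats_carrier, of A n k]
  by (intro bexI[of _ "1\<^sub>m n"] bexI[of _ 1]) auto

text \<open>The inverse of \<open>G\<close> is its adjugate times the inverse of its determinant, so it has entries in \<open>B\<close>.\<close>

lemma gl_equiv_sym:
  assumes A: "A \<in> mats n k" and "gl_equiv n A C" shows "gl_equiv n C A"
proof -
  obtain G u where G: "G \<in> mats n n" "u \<in> B" "Determinant.det G * u = 1" "C = G * A"
    using assms(2) by (auto simp: gl_equiv_def)
  let ?H = "u \<cdot>\<^sub>m adj_mat G"
  have c: "G \<in> carrier_mat n n" "A \<in> carrier_mat n k" "adj_mat G \<in> carrier_mat n n"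
    using mats_carrier G(1) A adj_mat(1) by blast+
  have HG: "?H * G = 1\<^sub>m n"
  proof -
    have "?H * G = u \<cdot>\<^sub>m (Determinant.det G \<cdot>\<^sub>m 1\<^sub>m n)"
      using c by (simp add: mult_smult_assoc_mat[of _ n n _ n] adj_mat)
    also have "\<dots> = 1\<^sub>m n" using G(3) by (intro eq_matI) (auto simp: mult.commute)
    finally show ?thesis .
  qed
  have "Determinant.det (?H * G) = Determinant.det ?H * Determinant.det G"
    using c by (intro det_mult) auto
  then have "Determinant.det ?H * Determinant.det G = 1" by (simp add: HG)
  moreover have "A = ?H * C"
    unfolding G(4) using c HG by (subst assoc_mult_mat[symmetric, of _ n n _ n _ k]) auto
  moreover have "?H \<in> mats n n" using G mats_adj mats_smult by blast
  ultimately show ?thesis unfolding gl_equiv_def using det_in[OF G(1)] by blast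
qed

lemma gl_equiv_trans:
  assumes A: "A \<in> mats n k" and "gl_equiv n A C" "gl_equiv n C D" shows "gl_equiv n A D"
proof -
  obtain G u where G: "G \<in> mats n n" "u \<in> B" "Determinant.det G * u = 1" "C = G * A"
    using assms(2) by (auto simp: gl_equiv_def)
  obtain H v where H: "H \<in> mats n n" "v \<in> B" "Determinant.det H * v = 1" "D = H * C"
    using assms(3) by (auto simp: gl_equiv_def)
  have c: "G \<in> carrier_mat n n" "A \<in> carrier_mat n k" "H \<in> carrier_mat n n"
    using mats_carrier G(1) A H(1) by blast+
  have "D = (H * G) * A" unfolding H(4) G(4) using c by simp
  moreover have "Determinant.det (H * G) * (u * v) = 1"
  proof -
    have "Determinant.det (H * G) * (u * v) = (Determinant.det H * v) * (Determinant.det G * u)"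
      using c by (simp add: det_mult[of _ n] mult_ac)
    then show ?thesis using G H by simp
  qed
  moreover have "H * G \<in> mats n n" "u * v \<in> B" using G H mats_mult mult_in by blast+
  ultimately show ?thesis unfolding gl_equiv_def by blast
qed

text \<open>The factor is \<open>G = 1 + (C - A) L\<close>: from \<open>L A = 1\<close> follows \<open>G A = C\<close>, and \<open>G\<close> tends to the identity
  because \<open>L\<close> stays bounded while \<open>C - A\<close> tends to \<open>0\<close>.  The form with a filter and varying \<open>A\<close>, \<open>L\<close>
  serves both for continuous paths and for a limit at the end of a path.\<close>

lemma gl_equiv_perturbation:
  assumes F: "eventually (\<lambda>t. A t \<in> mats n k \<and> C t \<in> mats n k \<and> L t \<in> mats k n \<and> L t * A t = 1\<^sub>m k \<and>
        (\<forall>i<k. \<forall>j<n. norm (L t $$ (i, j)) \<le> K)) F"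
    and lim: "\<And>i j. i < n \<Longrightarrow> j < k \<Longrightarrow> ((\<lambda>t. C t $$ (i, j) - A t $$ (i, j)) \<longlongrightarrow> 0) F"
  shows "eventually (\<lambda>t. gl_equiv n (A t) (C t)) F"
proof -
  let ?G = "\<lambda>t. 1\<^sub>m n + (C t - A t) * L t"
  have "((\<lambda>t. Determinant.det (?G t)) \<longlongrightarrow> 1) F"
  proof (rule tendsto_det_one)
    show "eventually (\<lambda>t. ?G t \<in> carrier_mat n n) F"
      using F by eventually_elim (auto dest!: mats_carrier)
    fix i j assume ij: "i < n" "j < n"
    have lim_sum: "((\<lambda>t. 1\<^sub>m n $$ (i, j) + (\<Sum>l<k. (C t $$ (i, l) - A t $$ (i, l)) * L t $$ (l, j)))
        \<longlongrightarrow> 1\<^sub>m n $$ (i, j) + (\<Sum>l<k. 0)) F"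
    proof (intro tendsto_add tendsto_const tendsto_sum)
      fix l assume l: "l \<in> {..<k}"
      show "((\<lambda>t. (C t $$ (i, l) - A t $$ (i, l)) * L t $$ (l, j)) \<longlongrightarrow> 0) F"
      proof (rule Lim_null_comparison)
        show "eventually (\<lambda>t. norm ((C t $$ (i, l) - A t $$ (i, l)) * L t $$ (l, j))
            \<le> norm (C t $$ (i, l) - A t $$ (i, l)) * K) F"
          using F
        proof eventually_elim
          case (elim t)
          then have "norm (L t $$ (l, j)) \<le> K" using ij l by simp
          then show ?case
            by (intro order_trans[OF norm_mult_ineq] mult_left_mono) auto
        qed
        have "((\<lambda>t. norm (C t $$ (i, l) - A t $$ (i, l)) * K) \<longlongrightarrow> norm (0 :: 'a) * K) F"
          using lim ij l by (intro tendsto_intros) auto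
        then show "((\<lambda>t. norm (C t $$ (i, l) - A t $$ (i, l)) * K) \<longlongrightarrow> 0) F" by simp
      qed
    qed
    have eq: "eventually (\<lambda>t. 1\<^sub>m n $$ (i, j) + (\<Sum>l<k. (C t $$ (i, l) - A t $$ (i, l)) * L t $$ (l, j))
        = ?G t $$ (i, j)) F"
      using F
    proof eventually_elim
      case (elim t)
      then have c: "A t \<in> carrier_mat n k" "C t \<in> carrier_mat n k" "L t \<in> carrier_mat k n"
        by (auto dest: mats_carrier)
      then have "((C t - A t) * L t) $$ (i, j) = (\<Sum>l<k. (C t - A t) $$ (i, l) * L t $$ (l, j))"
        using ij by (intro mult_mat_entry[of _ n _ _ n]) auto
      also have "\<dots> = (\<Sum>l<k. (C t $$ (i, l) - A t $$ (i, l)) * L t $$ (l, j))"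
        using c ij by (intro sum.cong) auto
      finally show ?case using c ij by simp
    qed
    show "((\<lambda>t. ?G t $$ (i, j)) \<longlongrightarrow> 1\<^sub>m n $$ (i, j)) F"
      using Lim_transform_eventually[OF lim_sum eq] by (simp only: sum.neutral_const add_0_right)
  qed
  then have "eventually (\<lambda>t. dist (Determinant.det (?G t)) 1 < 1) F"
    by (rule tendstoD) simp
  then show ?thesis using F
  proof eventually_elim
    case (elim t)
    have G: "?G t \<in> mats n n"
      using elim by (intro mats_add mats_one mats_mult[of _ n k] mats_diff) auto
    obtain u where u: "u \<in> B" "Determinant.det (?G t) * u = 1"
      by (rule unit_near_one[OF det_in[OF G]])
        (use elim in \<open>simp add: dist_norm norm_minus_commute\<close>)
    have c: "A t \<in> carrier_mat n k" "C t \<in> carrier_mat n k" "L t \<in> carrier_mat k n" "L t * A t = 1\<^sub>m k"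
      using elim by (auto dest: mats_carrier)
    have "?G t * A t = A t + (C t - A t) * (L t * A t)"
    proof -
      have D: "C t - A t \<in> carrier_mat n k" using c(1) by (rule minus_carrier_mat)
      have "?G t * A t = 1\<^sub>m n * A t + (C t - A t) * L t * A t"
        by (rule add_mult_distrib_mat[OF one_carrier_mat mult_carrier_mat[OF D c(3)] c(1)])
      then show ?thesis
        unfolding left_mult_one_mat[OF c(1)] assoc_mult_mat[OF D c(3) c(1)] .
    qed
    also have "\<dots> = C t"
      unfolding c(4) using c by (intro eq_matI) auto
    finally have "C t = ?G t * A t" by simp
    then show ?case unfolding gl_equiv_def using G u by blast
  qed
qed

text \<open>By perturbation each point of \<open>J\<close> has a neighbourhood on which all matrices are equivalent, and an
  equivalence relation with open classes on a connected set has a single class.\<close>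

lemma gl_equiv_path:
  fixes A :: "'t :: topological_space \<Rightarrow> 'a mat"
  assumes J: "connected J" "s \<in> J" "t \<in> J"
    and A: "\<And>t. t \<in> J \<Longrightarrow> A t \<in> mats n k"
    and cont: "\<And>i j. i < n \<Longrightarrow> j < k \<Longrightarrow> continuous_on J (\<lambda>t. A t $$ (i, j))"
    and L: "\<And>t. t \<in> J \<Longrightarrow> \<exists>L\<in>mats k n. L * A t = 1\<^sub>m k"
  shows "gl_equiv n (A s) (A t)"
proof (rule connected_equivalence_relation[OF J])
  show "gl_equiv n (A y) (A x)" if "gl_equiv n (A x) (A y)" "x \<in> J" for x y
    using gl_equiv_sym A that by blast
  show "gl_equiv n (A x) (A z)" if "gl_equiv n (A x) (A y)" "gl_equiv n (A y) (A z)" "x \<in> J" for x y z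
    using gl_equiv_trans A that by blast
  fix a assume a: "a \<in> J"
  obtain L where L: "L \<in> mats k n" "L * A a = 1\<^sub>m k" using L[OF a] by blast
  obtain K where K: "\<And>i j. i < k \<Longrightarrow> j < n \<Longrightarrow> norm (L $$ (i, j)) \<le> K"
    by (rule mat_entries_bounded) (rule that)
  have "eventually (\<lambda>t. gl_equiv n (A a) (A t)) (at a within J)"
  proof (rule gl_equiv_perturbation)
    have "eventually (\<lambda>t. t \<in> J) (at a within J)"
      unfolding eventually_at_filter by simp
    then show "eventually (\<lambda>t. A a \<in> mats n k \<and> A t \<in> mats n k \<and> L \<in> mats k n \<and> L * A a = 1\<^sub>m k \<and>
        (\<forall>i<k. \<forall>j<n. norm (L $$ (i, j)) \<le> K)) (at a within J)"
      by eventually_elim (use A a L K in auto)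
    show "((\<lambda>t. A t $$ (i, j) - A a $$ (i, j)) \<longlongrightarrow> 0) (at a within J)" if "i < n" "j < k" for i j
      using cont[OF that] a unfolding continuous_on_def by (simp add: LIM_zero)
  qed
  then obtain S where S: "open S" "a \<in> S" "\<And>x. x \<in> S \<Longrightarrow> x \<noteq> a \<Longrightarrow> x \<in> J \<Longrightarrow> gl_equiv n (A a) (A x)"
    unfolding eventually_at_topological by blast
  have "gl_equiv n (A a) (A x)" if "x \<in> J \<inter> S" for x
    using S(3)[of x] that gl_equiv_refl[OF A[OF a]] by (cases "x = a") auto
  then show "\<exists>T. openin (top_of_set J) T \<and> a \<in> T \<and> (\<forall>x\<in>T. gl_equiv n (A a) (A x))"
    using S a by (intro exI[of _ "J \<inter> S"]) (auto intro: openin_open_Int)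
qed

lemma mats_map_scal: "X \<in> carrier_mat n m \<Longrightarrow> map_mat scal X \<in> mats n m"
  by (auto simp: mats_def scal_in)

text \<open>Join the standard frame \<open>E\<close> to \<open>C\<close> by \<open>P w = (1 - w) E + w C\<close> with complex \<open>w\<close>, and correspondingly
  the transpose of \<open>E\<close> to \<open>L0\<close> by \<open>Q w\<close>.  The polynomial \<open>det (Q w * P w)\<close> equals \<open>1\<close> at \<open>w = 0\<close> and at
  \<open>w = 1\<close>, so it has finitely many zeros; off these \<open>P w\<close> is left invertible, and the complex plane
  without finitely many points is connected.\<close>

lemma gl_equiv_constant:
  assumes C: "C \<in> carrier_mat n k" and L0: "L0 \<in> carrier_mat k n" "L0 * C = 1\<^sub>m k" and kn: "k \<le> n"
  shows "gl_equiv n (std_frame n k) (map_mat scal C)"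
proof -
  interpret scal: comm_ring_hom scal
    by unfold_locales (auto simp: scal_add scal_mult scal_0 scal_1)
  define P where "P = (\<lambda>w. Matrix.mat n k (\<lambda>(i, j). (if i = j then 1 - w else 0) + w * C $$ (i, j)))"
  define Q where "Q = (\<lambda>w. Matrix.mat k n (\<lambda>(i, j). (if i = j then 1 - w else 0) + w * L0 $$ (i, j)))"
  \<comment> \<open>The same matrices with entries in the polynomial ring in \<open>w\<close>; their determinant exhibits
    \<open>det (Q w * P w)\<close> as a polynomial function.\<close>
  define Pp where "Pp = Matrix.mat n k (\<lambda>(i, j). [:if i = j then 1 else 0, C $$ (i, j) - (if i = j then 1 else 0):])"
  define Qp where "Qp = Matrix.mat k n (\<lambda>(i, j). [:if i = j then 1 else 0, L0 $$ (i, j) - (if i = j then 1 else 0):])"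
  have cP: "P w \<in> carrier_mat n k" "Q w \<in> carrier_mat k n" for w
    by (auto simp: P_def Q_def)
  have cPp: "Pp \<in> carrier_mat n k" "Qp \<in> carrier_mat k n"
    by (auto simp: Pp_def Qp_def)
  define d where "d = Determinant.det (Qp * Pp)"
  have d: "poly d w = Determinant.det (Q w * P w)" for w
  proof -
    interpret ev: comm_ring_hom "\<lambda>p. poly p w" by unfold_locales auto
    have "map_mat (\<lambda>p. poly p w) Pp = P w" "map_mat (\<lambda>p. poly p w) Qp = Q w"
      by (auto simp: P_def Q_def Pp_def Qp_def algebra_simps)
    then have "map_mat (\<lambda>p. poly p w) (Qp * Pp) = Q w * P w"
      using ev.mat_hom_mult[OF cPp(2,1)] by simp
    then show ?thesis using ev.hom_det[of "Qp * Pp"] by (simp add: d_def)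
  qed
  have P01: "P 0 = std_frame n k" "P 1 = C" "Q 1 = L0"
    using C L0 by (auto simp: P_def Q_def std_frame_def)
  have "Q 0 * P 0 = 1\<^sub>m k"
  proof (rule eq_matI)
    show "(Q 0 * P 0) $$ (i, j) = 1\<^sub>m k $$ (i, j)" if "i < dim_row (1\<^sub>m k)" "j < dim_col (1\<^sub>m k)" for i j
      using that mult_std_frame[of "Q 0" k n k i j] cP(2)[of 0] kn by (auto simp: P01 Q_def)
  qed (use cP in auto)
  then have d01: "poly d 0 = 1" "poly d 1 = 1" using d[of 0] d[of 1] P01 L0 by auto
  then have "finite {w. poly d w = 0}" by (intro poly_roots_finite) auto
  then have conn: "connected (UNIV - {w. poly d w = 0})"
    by (intro connected_open_delete_finite) auto
  have "gl_equiv n (map_mat scal (P 0)) (map_mat scal (P 1))"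
  proof (rule gl_equiv_path[OF conn])
    show "(0 :: complex) \<in> UNIV - {w. poly d w = 0}" "1 \<in> UNIV - {w. poly d w = 0}"
      using d01 by auto
    show "map_mat scal (P w) \<in> mats n k" for w
      using cP(1) by (rule mats_map_scal)
    show "continuous_on (UNIV - {w. poly d w = 0}) (\<lambda>w. map_mat scal (P w) $$ (i, j))"
      if "i < n" "j < k" for i j
    proof -
      have "dist (scal x) (scal y) = dist x y" for x y
        by (simp add: dist_norm norm_scal scal_diff[symmetric])
      then have "continuous_on UNIV scal"
        unfolding continuous_on_iff by auto
      then show ?thesis using that
        by (cases "i = j")
          (auto simp: P_def intro!: continuous_on_compose2[of UNIV scal] continuous_intros)
    qed
    show "\<exists>L\<in>mats k n. L * map_mat scal (P w) = 1\<^sub>m k" if w: "w \<in> UNIV - {w. poly d w = 0}" for w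
    proof -
      let ?D = "Q w * P w"
      have D: "?D \<in> carrier_mat k k" "Determinant.det ?D \<noteq> 0" using cP[of w] w d[of w] by auto
      let ?L = "(1 / Determinant.det ?D) \<cdot>\<^sub>m (adj_mat ?D * Q w)"
      have L: "?L \<in> carrier_mat k n" using adj_mat(1)[OF D(1)] cP[of w] by auto
      have "?L * P w = (1 / Determinant.det ?D) \<cdot>\<^sub>m (adj_mat ?D * ?D)"
        using adj_mat(1)[OF D(1)] cP[of w]
        by (simp add: mult_smult_assoc_mat[of _ k n _ k] assoc_mult_mat[of _ k k _ n _ k])
      also have "\<dots> = 1\<^sub>m k"
        unfolding adj_mat(3)[OF D(1)] using D by (intro eq_matI) auto
      finally have LP: "?L * P w = 1\<^sub>m k" .
      have "map_mat scal ?L * map_mat scal (P w) = 1\<^sub>m k"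
        using scal.mat_hom_mult[OF L cP(1)[of w]] LP by (simp add: scal.mat_hom_one)
      moreover have "map_mat scal ?L \<in> mats k n" using L by (rule mats_map_scal)
      ultimately show ?thesis by blast
    qed
  qed
  moreover have "map_mat scal (std_frame n k) = std_frame n k"
    by (auto simp: std_frame_def scal_0 scal_1)
  ultimately show ?thesis by (simp add: P01)
qed

text \<open>The equivalence presents \<open>A\<close> as the first \<open>k\<close> columns of a matrix \<open>G\<close> whose determinant is a unit.
  Multiplying the last column of \<open>G\<close> by the inverse of the determinant normalises it, and does not
  touch \<open>A\<close> because \<open>k < n\<close>.\<close>

lemma completion_if_gl_equiv_std_frame:
  assumes "gl_equiv n (std_frame n k) A" "k < n"
  shows "\<exists>C\<in>mats n n. (\<forall>i<n. \<forall>j<k. C $$ (i, j) = A $$ (i, j)) \<and> Determinant.det C = 1"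
proof -
  obtain G u where G: "G \<in> mats n n" "u \<in> B" "Determinant.det G * u = 1" "A = G * std_frame n k"
    using assms(1) by (auto simp: gl_equiv_def)
  let ?D = "multrow_mat n (n - 1) u"
  have c: "G \<in> carrier_mat n n" "?D \<in> carrier_mat n n" using mats_carrier G by auto
  have "?D \<in> mats n n" using c(2) G(2) by (intro matsI) (auto simp: multrow_mat_def one_in zero_in)
  then have "G * ?D \<in> mats n n" using G mats_mult by blast
  moreover have "Determinant.det (G * ?D) = 1"
    using det_mult[OF c] det_multrow_mat[of "n - 1" n u] assms(2) G(3) by simp
  moreover have "(G * ?D) $$ (i, j) = A $$ (i, j)" if "i < n" "j < k" for i j
  proof -
    have "(G * ?D) $$ (i, j) = (\<Sum>l<n. G $$ (i, l) * ?D $$ (l, j))"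
      using that assms(2) by (intro mult_mat_entry[OF c]) auto
    also have "\<dots> = (\<Sum>l<n. if l = j then G $$ (i, j) else 0)"
      using that assms(2) by (intro sum.cong) auto
    also have "\<dots> = A $$ (i, j)"
      unfolding G(4) using that assms(2) by (subst mult_std_frame[OF c(1)]) (auto simp: sum.delta)
    finally show ?thesis .
  qed
  ultimately show ?thesis by blast
qed

lemma pick_initial: "j < k \<Longrightarrow> pick {0..<k} j = j"
  using pick_reduce_set[of j k UNIV] by (simp add: pick_UNIV atLeast0LessThan flip: lessThan_def)

lemma submatrix_select_rows:
  assumes A: "A \<in> carrier_mat n k" and I: "I \<subseteq> {0..<n}" "card I = m"
  shows "submatrix A I {0..<k} \<in> carrier_mat m k"
    and "i < m \<Longrightarrow> j < k \<Longrightarrow> submatrix A I {0..<k} $$ (i, j) = A $$ (pick I i, j)"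
proof -
  have 1: "{i. i < n \<and> i \<in> I} = I" using I by auto
  show "submatrix A I {0..<k} \<in> carrier_mat m k"
    using A I by (simp add: submatrix_def 1)
  show "submatrix A I {0..<k} $$ (i, j) = A $$ (pick I i, j)" if "i < m" "j < k"
    using A I that by (simp add: submatrix_def 1 pick_initial)
qed

lemma minor_in:
  assumes "A \<in> mats n k" "I \<subseteq> {0..<n}" "card I = k"
  shows "submatrix A I {0..<k} \<in> mats k k"
proof (rule matsI)
  note s = submatrix_select_rows[OF mats_carrier[OF assms(1)] assms(2,3)]
  show "submatrix A I {0..<k} \<in> carrier_mat k k" by (rule s(1))
  show "submatrix A I {0..<k} $$ (i, j) \<in> B" if "i < k" "j < k" for i j
    unfolding s(2)[OF that] using pick_in_set_le[of i I] assms that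
    by (intro mats_entry[OF assms(1)]) auto
qed

text \<open>The scalars \<open>c\<close> such that \<open>c \<cdot> 1 = L A\<close> for some \<open>L\<close> over \<open>B\<close> form an ideal.  If \<open>S\<close> selects the
  rows of a maximal minor, so that \<open>S A\<close> is the square submatrix, then \<open>adj (S A) S A = det (S A) 1\<close>
  shows that the minor belongs to this ideal.  A proper ideal is annihilated by a character.\<close>

lemma left_inverse_or_character:
  assumes A: "A \<in> mats n k" and noL: "\<not> (\<exists>L\<in>mats k n. L * A = 1\<^sub>m k)"
  obtains \<phi> where "\<phi> \<in> extensional B" "\<phi> 1 = 1"
    "\<And>I. I \<subseteq> {0..<n} \<Longrightarrow> card I = k \<Longrightarrow> \<phi> (Determinant.det (submatrix A I {0..<k})) = 0"
    "\<And>a b. a \<in> B \<Longrightarrow> b \<in> B \<Longrightarrow> \<phi> (a + b) = \<phi> a + \<phi> b"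
    "\<And>a b. a \<in> B \<Longrightarrow> b \<in> B \<Longrightarrow> \<phi> (a * b) = \<phi> a * \<phi> b"
    "\<And>c a. a \<in> B \<Longrightarrow> \<phi> (scal c * a) = c * \<phi> a"
proof -
  note cA = mats_carrier[OF A]
  let ?I = "{c \<in> B. \<exists>L\<in>mats k n. L * A = c \<cdot>\<^sub>m 1\<^sub>m k}"
  have "ideal ?I"
    unfolding ideal_def
  proof (intro conjI ballI)
    have "0\<^sub>m k n \<in> mats k n" by (auto simp: mats_def zero_in)
    moreover have "0\<^sub>m k n * A = 0 \<cdot>\<^sub>m 1\<^sub>m k" using cA by (intro eq_matI) auto
    ultimately show "0 \<in> ?I" using zero_in by blast
  next
    fix x y assume "x \<in> ?I" "y \<in> ?I"
    then obtain L L' where L: "L \<in> mats k n" "L * A = x \<cdot>\<^sub>m 1\<^sub>m k" "L' \<in> mats k n" "L' * A = y \<cdot>\<^sub>m 1\<^sub>m k"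
      and xy: "x \<in> B" "y \<in> B" by blast
    have "(L + L') * A = x \<cdot>\<^sub>m 1\<^sub>m k + y \<cdot>\<^sub>m 1\<^sub>m k"
      using L cA by (subst add_mult_distrib_mat[of _ k n _ _ k]) (auto dest: mats_carrier)
    also have "\<dots> = (x + y) \<cdot>\<^sub>m 1\<^sub>m k" by (intro eq_matI) auto
    finally have "(L + L') * A = (x + y) \<cdot>\<^sub>m 1\<^sub>m k" .
    then show "x + y \<in> ?I" using L xy mats_add add_in by blast
  next
    fix b x assume b: "b \<in> B" and "x \<in> ?I"
    then obtain L where L: "L \<in> mats k n" "L * A = x \<cdot>\<^sub>m 1\<^sub>m k" and x: "x \<in> B" by blast
    have "(b \<cdot>\<^sub>m L) * A = b \<cdot>\<^sub>m (x \<cdot>\<^sub>m 1\<^sub>m k)"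
      using L cA by (subst mult_smult_assoc_mat[of _ k n _ k]) (auto dest: mats_carrier)
    also have "\<dots> = (b * x) \<cdot>\<^sub>m 1\<^sub>m k" by (intro eq_matI) auto
    finally have "(b \<cdot>\<^sub>m L) * A = (b * x) \<cdot>\<^sub>m 1\<^sub>m k" .
    then show "b * x \<in> ?I" using L b x mats_smult mult_in by blast
  qed auto
  moreover have "1 \<notin> ?I"
  proof
    assume "1 \<in> ?I"
    then obtain L where "L \<in> mats k n" "L * A = 1 \<cdot>\<^sub>m 1\<^sub>m k" by blast
    moreover have "1 \<cdot>\<^sub>m 1\<^sub>m k = (1\<^sub>m k :: 'a mat)" by (intro eq_matI) auto
    ultimately show False using noL by metis
  qed
  ultimately obtain \<phi> where \<phi>: "\<phi> \<in> extensional B" "\<And>a. a \<in> ?I \<Longrightarrow> \<phi> a = 0" "\<phi> 1 = 1"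
    "\<And>a b. a \<in> B \<Longrightarrow> b \<in> B \<Longrightarrow> \<phi> (a + b) = \<phi> a + \<phi> b"
    "\<And>a b. a \<in> B \<Longrightarrow> b \<in> B \<Longrightarrow> \<phi> (a * b) = \<phi> a * \<phi> b"
    "\<And>c a. a \<in> B \<Longrightarrow> \<phi> (scal c * a) = c * \<phi> a"
    by (rule character_vanishing_on_ideal) (rule that)
  have minor: "Determinant.det (submatrix A I {0..<k}) \<in> ?I" if I: "I \<subseteq> {0..<n}" "card I = k" for I
  proof -
    let ?A = "submatrix A I {0..<k}"
    have m: "?A \<in> mats k k" using minor_in A I by blast
    let ?S = "Matrix.mat k n (\<lambda>(i, j). if j = pick I i then 1 else 0 :: 'a)"
    have S: "?S \<in> mats k n" by (auto simp: mats_def one_in zero_in)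
    have "?S * A = ?A"
    proof (rule eq_matI)
      show "dim_row (?S * A) = dim_row ?A" "dim_col (?S * A) = dim_col ?A"
        using mats_carrier[OF m] cA by auto
      fix i j assume "i < dim_row ?A" "j < dim_col ?A"
      then have ij: "i < k" "j < k" using mats_carrier[OF m] by auto
      have "pick I i < n" using pick_in_set_le[of i I] ij I by auto
      have "(?S * A) $$ (i, j) = (\<Sum>l<n. ?S $$ (i, l) * A $$ (l, j))"
        using ij S cA by (intro mult_mat_entry[of _ k _ _ k]) (auto dest: mats_carrier)
      also have "\<dots> = (\<Sum>l<n. if l = pick I i then A $$ (pick I i, j) else 0)"
        using ij by (intro sum.cong) auto
      also have "\<dots> = ?A $$ (i, j)"
        using \<open>pick I i < n\<close> submatrix_select_rows(2)[OF cA I ij] by (simp add: sum.delta)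
      finally show "(?S * A) $$ (i, j) = ?A $$ (i, j)" .
    qed
    then have "(adj_mat ?A * ?S) * A = Determinant.det ?A \<cdot>\<^sub>m 1\<^sub>m k"
      using adj_mat[OF mats_carrier[OF m]] S cA
      by (subst assoc_mult_mat[of _ k k _ n _ k]) (auto dest: mats_carrier)
    moreover have "adj_mat ?A * ?S \<in> mats k n" by (rule mats_mult[OF mats_adj[OF m] S])
    ultimately show ?thesis using det_in[OF m] by (intro CollectI conjI bexI)
  qed
  show thesis
    by (rule that[OF \<phi>(1) \<phi>(3) _ \<phi>(4-6)]) (rule \<phi>(2)[OF minor])
qed

end

section \<open>Bounded holomorphic extension to the half-plane\<close>

text \<open>The Phragmen--Lindelof principle for bounded functions.  Dividing \<open>F\<close> by \<open>1 - i e w\<close>, which has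
  modulus at least \<open>1\<close> on the half-plane and grows linearly, makes it small on large half-circles, so
  that the maximum principle applies to a half-disc; finally \<open>e\<close> tends to \<open>0\<close>.\<close>

lemma phragmen_lindelof_half_plane:
  assumes cont: "continuous_on {z. 0 \<le> Im z} F" and hol: "F holomorphic_on {z. 0 < Im z}"
    and bdd: "bounded (F ` {z. 0 \<le> Im z})"
    and real: "\<And>x :: real. cmod (F (of_real x)) \<le> M" and z: "0 \<le> Im z"
  shows "cmod (F z) \<le> M"
proof (cases "Im z = 0")
  case True
  then have "z = of_real (Re z)" by (simp add: complex_eq_iff)
  then show ?thesis using real by metis
next
  case False
  with z have z: "0 < Im z" by simp
  obtain C where C: "\<And>w. 0 \<le> Im w \<Longrightarrow> cmod (F w) \<le> C" "C > 0"
    using bdd unfolding bounded_pos by auto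
  have M0: "M \<ge> 0" using real[of 0] norm_ge_zero order_trans by blast
  have main: "cmod (F z) \<le> (M + e) * (1 + e * cmod z)" if e: "e > 0" for e
  proof -
    let ?h = "\<lambda>w. 1 - \<i> * of_real e * w"
    have h1: "1 \<le> cmod (?h w)" if "0 \<le> Im w" for w
    proof -
      have "1 \<le> Re (?h w)" using that e by simp
      then show ?thesis using complex_Re_le_cmod order_trans by blast
    qed
    have h2: "e * cmod w - 1 \<le> cmod (?h w)" for w
      using norm_triangle_ineq3[of 1 "\<i> * of_real e * w"] e by (simp add: norm_mult)
    obtain R where R: "R > cmod z" "e * R > 1" "C \<le> (M + e) * (e * R - 1)"
    proof
      let ?R = "cmod z + (1 + C / (M + e)) / e + 1"
      have "C / (M + e) > 0" using C M0 e by simp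
      then show "?R > cmod z" using e by (simp add: add_pos_pos)
      have "e * ?R = e * cmod z + (1 + C / (M + e)) + e"
        using e by (simp add: field_simps)
      then have *: "e * ?R - 1 \<ge> C / (M + e)" "e * ?R > 1"
        using e \<open>C / (M + e) > 0\<close> mult_nonneg_nonneg[OF less_imp_le[OF e] norm_ge_zero[of z]]
        by linarith+
      show "e * ?R > 1" by fact
      have "C = (M + e) * (C / (M + e))" using M0 e by simp
      also have "\<dots> \<le> (M + e) * (e * ?R - 1)" using * M0 e by (intro mult_left_mono) auto
      finally show "C \<le> (M + e) * (e * ?R - 1)" .
    qed
    let ?S = "{w. 0 < Im w} \<inter> ball 0 R"
    have S: "open ?S" by (intro open_Int open_halfspace_Im_gt open_ball)
    have clS: "closure ?S \<subseteq> {w. 0 \<le> Im w} \<inter> cball 0 R"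
      by (intro closure_minimal closed_Int closed_halfspace_Im_ge closed_cball) auto
    have h0: "?h w \<noteq> 0" if "0 \<le> Im w" for w
      using h1[OF that] by (metis norm_zero not_one_le_zero)
    have "cmod (F z / ?h z) \<le> M + e"
    proof (rule maximum_modulus_frontier[of "\<lambda>w. F w / ?h w" ?S])
      show "(\<lambda>w. F w / ?h w) holomorphic_on interior ?S"
        unfolding interior_open[OF S]
        by (intro holomorphic_intros holomorphic_on_subset[OF hol]) (use h0 in auto)
      show "continuous_on (closure ?S) (\<lambda>w. F w / ?h w)"
        using clS h0 by (intro continuous_intros continuous_on_subset[OF cont]) auto
      show "bounded ?S" by (rule bounded_subset[OF bounded_ball[of 0 R]]) auto
      show "z \<in> ?S" using z R by simp
      fix w assume "w \<in> frontier ?S"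
      then have "w \<in> {w. 0 \<le> Im w} \<inter> cball 0 R" "w \<notin> ?S"
        using clS interior_open[OF S] unfolding frontier_def by blast+
      then have w: "0 \<le> Im w" "cmod w \<le> R" "Im w = 0 \<or> cmod w = R" by auto
      show "cmod (F w / ?h w) \<le> M + e"
      proof (cases "Im w = 0")
        case True
        then have "w = of_real (Re w)" by (simp add: complex_eq_iff)
        then have "cmod (F w) \<le> M" using real by metis
        also have "\<dots> \<le> (M + e) * 1" using e by simp
        also have "\<dots> \<le> (M + e) * cmod (?h w)" using h1[OF w(1)] M0 e by (intro mult_left_mono) auto
        finally show ?thesis using h0[OF w(1)] by (simp add: norm_divide pos_divide_le_eq)
      next
        case False
        then have "cmod w = R" using w by simp
        have "cmod (F w) \<le> C" using C w by simp
        also have "\<dots> \<le> (M + e) * (e * R - 1)" by (rule R)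
        also have "\<dots> \<le> (M + e) * cmod (?h w)"
          using h2[of w] \<open>cmod w = R\<close> M0 e by (intro mult_left_mono) auto
        finally show ?thesis using h0[OF w(1)] by (simp add: norm_divide pos_divide_le_eq)
      qed
    qed
    then have "cmod (F z) \<le> (M + e) * cmod (?h z)"
      using h0[of z] z by (simp add: norm_divide pos_divide_le_eq)
    also have "\<dots> \<le> (M + e) * (1 + e * cmod z)"
      using norm_triangle_ineq4[of 1 "\<i> * of_real e * z"] M0 e
      by (intro mult_left_mono) (auto simp: norm_mult)
    finally show ?thesis .
  qed
  have "((\<lambda>e. (M + e) * (1 + e * cmod z)) \<longlongrightarrow> (M + 0) * (1 + 0 * cmod z)) (at_right 0)"
    by (intro tendsto_intros)
  moreover have "eventually (\<lambda>e. cmod (F z) \<le> (M + e) * (1 + e * cmod z)) (at_right 0)"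
    using main by (auto simp: eventually_at_right_field intro!: exI[of _ 1])
  ultimately have "cmod (F z) \<le> (M + 0) * (1 + 0 * cmod z)"
    by (rule tendsto_lowerbound) simp
  then show ?thesis by simp
qed

text \<open>Instead of the Poisson integral, the extension is characterised by being bounded, continuous up to
  the real line and holomorphic inside; by \<open>bounded_extension_norm_le\<close> this determines it.
  Compatibility with sums and products is then immediate.\<close>

definition bounded_extension :: "(real \<Rightarrow>\<^sub>C complex) \<Rightarrow> (complex \<Rightarrow> complex) \<Rightarrow> bool" where
  "bounded_extension a F \<longleftrightarrow> continuous_on {z. 0 \<le> Im z} F \<and> F holomorphic_on {z. 0 < Im z} \<and>
     bounded (F ` {z. 0 \<le> Im z}) \<and> (\<forall>x. F (of_real x) = a x)"

lemma bounded_extension_norm_le: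
  assumes F: "bounded_extension a F" and z: "0 \<le> Im z" shows "cmod (F z) \<le> norm a"
proof (rule phragmen_lindelof_half_plane[OF _ _ _ _ z])
  show "cmod (F (of_real x)) \<le> norm a" for x :: real
    using F norm_bounded[of a x] by (simp add: bounded_extension_def)
qed (use F in \<open>auto simp: bounded_extension_def\<close>)

lemma bounded_extension_const: "bounded_extension (const_bcontfun c) (\<lambda>_. c)"
  unfolding bounded_extension_def bounded_iff by (auto intro!: exI[of _ "cmod c"])

lemma bounded_extension_add:
  assumes "bounded_extension a F" "bounded_extension b G"
  shows "bounded_extension (a + b) (\<lambda>z. F z + G z)"
  using assms unfolding bounded_extension_def
  by (auto intro!: continuous_intros holomorphic_intros bounded_plus_comp)

lemma bounded_extension_mult:
  assumes "bounded_extension a F" "bounded_extension b G"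
  shows "bounded_extension (a * b) (\<lambda>z. F z * G z)"
proof -
  have "bounded ((\<lambda>z. F z * G z) ` {z. 0 \<le> Im z})"
    unfolding bounded_iff
  proof (intro exI[of _ "norm a * norm b"] ballI)
    fix y assume "y \<in> (\<lambda>z. F z * G z) ` {z. 0 \<le> Im z}"
    then obtain z where "0 \<le> Im z" "y = F z * G z" by auto
    then show "norm y \<le> norm a * norm b"
      using bounded_extension_norm_le assms by (auto simp: norm_mult intro!: mult_mono)
  qed
  then show ?thesis using assms unfolding bounded_extension_def
    by (auto intro!: continuous_intros holomorphic_intros)
qed

lemma bounded_extension_diff:
  assumes "bounded_extension a F" "bounded_extension b G"
  shows "bounded_extension (a - b) (\<lambda>z. F z - G z)"
proof -
  have eq: "a - b = a + const_bcontfun (-1) * b" by (rule bcontfun_eqI) simp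
  show ?thesis
    unfolding eq
    using bounded_extension_add[OF assms(1) bounded_extension_mult[OF bounded_extension_const[of "-1"] assms(2)]]
    by simp
qed

lemma bounded_extension_unique:
  assumes "bounded_extension a F" "bounded_extension a G" "0 \<le> Im z"
  shows "F z = G z"
  using bounded_extension_norm_le[OF bounded_extension_diff[OF assms(1,2)] assms(3)] by simp

lemma bounded_extension_ap_exp:
  assumes "0 \<le> l" shows "bounded_extension (ap_exp l) (\<lambda>z. exp (\<i> * of_real l * z))"
  unfolding bounded_extension_def
proof (intro conjI)
  show "bounded ((\<lambda>z. exp (\<i> * of_real l * z)) ` {z. 0 \<le> Im z})"
    unfolding bounded_iff using assms by (intro exI[of _ 1]) auto
qed (auto intro!: continuous_intros holomorphic_intros simp: ap_exp.rep_eq)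

definition extendable :: "(real \<Rightarrow>\<^sub>C complex) set" where
  "extendable = {a. \<exists>F. bounded_extension a F}"

text \<open>The extensions of a uniformly convergent sequence are uniformly Cauchy on the closed half-plane by
  the maximum principle, and a uniform limit of holomorphic functions is holomorphic.\<close>

lemma closed_extendable: "closed extendable"
  unfolding closed_sequential_limits
proof (intro allI impI, elim conjE)
  fix a :: "nat \<Rightarrow> real \<Rightarrow>\<^sub>C complex" and b
  let ?U = "{z. 0 \<le> Im z}"
  assume a: "\<forall>n. a n \<in> extendable" and lim: "a \<longlonglongrightarrow> b"
  have "\<forall>n. \<exists>F. bounded_extension (a n) F" using a by (simp add: extendable_def)
  from choice[OF this] obtain F where F: "\<And>n. bounded_extension (a n) (F n)" by blast
  have "uniformly_Cauchy_on ?U F"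
    unfolding uniformly_Cauchy_on_def
  proof (intro allI impI)
    fix e :: real assume "e > 0"
    then obtain N where N: "\<And>m n. m \<ge> N \<Longrightarrow> n \<ge> N \<Longrightarrow> norm (a m - a n) < e"
      using CauchyD[OF LIMSEQ_imp_Cauchy[OF lim]] by blast
    have "dist (F m z) (F n z) < e" if "z \<in> ?U" "m \<ge> N" "n \<ge> N" for m n z
      using bounded_extension_norm_le[OF bounded_extension_diff[OF F F], of z m n] that N[of m n]
      by (simp add: dist_norm)
    then show "\<exists>M. \<forall>x\<in>?U. \<forall>m\<ge>M. \<forall>n\<ge>M. dist (F m x) (F n x) < e"
      by (intro exI[of _ N]) simp
  qed
  then obtain G where G: "uniform_limit ?U F G sequentially"
    using Cauchy_uniformly_convergent[of ?U F] unfolding uniformly_convergent_on_def by blast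
  have "bounded_extension b G"
    unfolding bounded_extension_def
  proof (intro conjI allI)
    show "continuous_on ?U G"
      by (rule uniform_limit_theorem[OF _ G])
        (use F in \<open>simp_all add: bounded_extension_def\<close>)
    show "G holomorphic_on {z. 0 < Im z}"
    proof (rule holomorphic_uniform_sequence[of _ F])
      show "open {z. 0 < Im z}" by (rule open_halfspace_Im_gt)
      show "F n holomorphic_on {z. 0 < Im z}" for n using F by (simp add: bounded_extension_def)
      fix z assume z: "z \<in> {z. 0 < Im z}"
      have sub: "cball z (Im z / 2) \<subseteq> {z. 0 < Im z}"
      proof
        fix w assume "w \<in> cball z (Im z / 2)"
        then have "\<bar>Im (z - w)\<bar> \<le> Im z / 2"
          using abs_Im_le_cmod[of "z - w"] by (simp add: dist_norm)
        then have "Im w \<ge> Im z / 2" unfolding minus_complex.sel by linarith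
        then show "w \<in> {z. 0 < Im z}" using z by simp
      qed
      also have "{z. 0 < Im z} \<subseteq> ?U" by auto
      finally have "uniform_limit (cball z (Im z / 2)) F G sequentially"
        by (rule uniform_limit_on_subset[OF G])
      then show "\<exists>d>0. cball z d \<subseteq> {z. 0 < Im z} \<and> uniform_limit (cball z d) F G sequentially"
        using sub z by (intro exI[of _ "Im z / 2"]) auto
    qed
    have pt: "(\<lambda>n. F n z) \<longlonglongrightarrow> G z" if "0 \<le> Im z" for z
      using tendsto_uniform_limitI[OF G] that by simp
    have "Bseq a" by (rule convergent_imp_Bseq[OF convergentI[OF lim]])
    then obtain K where "\<forall>n. norm (a n) \<le> K" by (rule BseqE)
    then have K: "norm (a n) \<le> K" for n by simp
    have "cmod (G z) \<le> K" if "0 \<le> Im z" for z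
    proof (rule tendsto_upperbound[OF tendsto_norm[OF pt[OF that]]])
      show "\<forall>\<^sub>F n in sequentially. cmod (F n z) \<le> K"
        using order_trans[OF bounded_extension_norm_le[OF F that] K] by simp
    qed simp
    then show "bounded (G ` ?U)" unfolding bounded_iff by (intro exI[of _ K]) simp
    fix x :: real
    have "(\<lambda>n. F n (of_real x)) \<longlonglongrightarrow> b x"
    proof -
      have "(\<lambda>n. a n x - b x) \<longlonglongrightarrow> 0"
      proof (rule Lim_null_comparison)
        show "\<forall>\<^sub>F n in sequentially. norm (a n x - b x) \<le> norm (a n - b)"
          using norm_bounded[of "a _ - b" x] by simp
        show "(\<lambda>n. norm (a n - b)) \<longlonglongrightarrow> 0"
          using lim by (simp add: tendsto_norm_zero LIM_zero)
      qed
      then show ?thesis using F by (simp add: bounded_extension_def LIM_zero_iff)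
    qed
    moreover have "(\<lambda>n. F n (of_real x)) \<longlonglongrightarrow> G (of_real x)" by (rule pt) simp
    ultimately show "G (of_real x) = b x" by (rule LIMSEQ_unique[rotated])
  qed
  then show "b \<in> extendable" unfolding extendable_def by blast
qed

text \<open>The choice of the extension does not matter on the closed half-plane, by uniqueness.\<close>

definition shift :: "real \<Rightarrow> (real \<Rightarrow>\<^sub>C complex) \<Rightarrow> real \<Rightarrow>\<^sub>C complex" where
  "shift t a = Bcontfun (\<lambda>x. (SOME F. bounded_extension a F) (of_real x + \<i> * of_real t))"

lemma shift_apply:
  assumes F: "bounded_extension a F" and t: "0 \<le> t"
  shows "shift t a x = F (of_real x + \<i> * of_real t)"
proof -
  define G where "G = (SOME F. bounded_extension a F)"
  have G: "bounded_extension a G" unfolding G_def by (rule someI[of "bounded_extension a", OF F])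
  have "(\<lambda>x :: real. G (of_real x + \<i> * of_real t)) \<in> bcontfun"
  proof (rule bcontfun_normI)
    show "continuous_on UNIV (\<lambda>x :: real. G (of_real x + \<i> * of_real t))"
    proof (rule continuous_on_compose2[of "{z. 0 \<le> Im z}" G])
      show "continuous_on {z. 0 \<le> Im z} G" using G by (simp add: bounded_extension_def)
      show "continuous_on UNIV (\<lambda>x :: real. of_real x + \<i> * of_real t)"
        by (intro continuous_intros)
    qed (use t in auto)
    show "norm (G (of_real x + \<i> * of_real t)) \<le> norm a" for x
      by (rule bounded_extension_norm_le[OF G]) (simp add: t)
  qed
  then have "shift t a x = G (of_real x + \<i> * of_real t)"
    by (simp add: shift_def G_def[symmetric] Bcontfun_inverse)
  also have "\<dots> = F (of_real x + \<i> * of_real t)"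
    by (rule bounded_extension_unique[OF G F]) (simp add: t)
  finally show ?thesis .
qed

context
  fixes t :: real assumes t: "0 \<le> t"
begin

lemma shift_const [simp]: "shift t (const_bcontfun c) = const_bcontfun c"
  by (rule bcontfun_eqI) (simp add: shift_apply[OF bounded_extension_const t])

lemma shift_add:
  assumes "a \<in> extendable" "b \<in> extendable" shows "shift t (a + b) = shift t a + shift t b"
proof -
  obtain F G where FG: "bounded_extension a F" "bounded_extension b G"
    using assms by (auto simp: extendable_def)
  show ?thesis
    by (rule bcontfun_eqI)
      (simp add: shift_apply[OF FG(1) t] shift_apply[OF FG(2) t]
        shift_apply[OF bounded_extension_add[OF FG] t])
qed

lemma shift_mult:
  assumes "a \<in> extendable" "b \<in> extendable" shows "shift t (a * b) = shift t a * shift t b"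
proof -
  obtain F G where FG: "bounded_extension a F" "bounded_extension b G"
    using assms by (auto simp: extendable_def)
  show ?thesis
    by (rule bcontfun_eqI)
      (simp add: shift_apply[OF FG(1) t] shift_apply[OF FG(2) t]
        shift_apply[OF bounded_extension_mult[OF FG] t])
qed

lemma shift_diff:
  assumes "a \<in> extendable" "b \<in> extendable" shows "shift t (a - b) = shift t a - shift t b"
proof -
  obtain F G where FG: "bounded_extension a F" "bounded_extension b G"
    using assms by (auto simp: extendable_def)
  show ?thesis
    by (rule bcontfun_eqI)
      (simp add: shift_apply[OF FG(1) t] shift_apply[OF FG(2) t]
        shift_apply[OF bounded_extension_diff[OF FG] t])
qed

lemma norm_shift_le:
  assumes "a \<in> extendable" shows "norm (shift t a) \<le> norm a"
proof -
  obtain F where F: "bounded_extension a F" using assms by (auto simp: extendable_def)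
  show ?thesis
  proof (rule norm_bound)
    show "norm (shift t a x) \<le> norm a" for x
      unfolding shift_apply[OF F t] by (rule bounded_extension_norm_le[OF F]) (simp add: t)
  qed
qed

lemma shift_ap_exp:
  assumes "0 \<le> l"
  shows "shift t (ap_exp l) = const_bcontfun (of_real (exp (- l * t))) * ap_exp l"
proof (rule bcontfun_eqI)
  fix x :: real
  have "\<i> * of_real l * (of_real x + \<i> * of_real t) = of_real (- l * t) + \<i> * of_real l * of_real x"
    by (simp add: algebra_simps)
  then show "shift t (ap_exp l) x = (const_bcontfun (of_real (exp (- l * t))) * ap_exp l) x"
    by (simp only: shift_apply[OF bounded_extension_ap_exp[OF assms] t] times_bcontfun.rep_eq
        const_bcontfun.rep_eq ap_exp.rep_eq exp_add exp_of_real)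
qed

end

lemma shift_0:
  assumes "a \<in> extendable" shows "shift 0 a = a"
proof -
  obtain F where F: "bounded_extension a F" using assms by (auto simp: extendable_def)
  show ?thesis
    using F by (intro bcontfun_eqI) (simp add: shift_apply[OF F] bounded_extension_def)
qed

lemma extendable_add: "a \<in> extendable \<Longrightarrow> b \<in> extendable \<Longrightarrow> a + b \<in> extendable"
  unfolding extendable_def using bounded_extension_add by fast

lemma extendable_mult: "a \<in> extendable \<Longrightarrow> b \<in> extendable \<Longrightarrow> a * b \<in> extendable"
  unfolding extendable_def using bounded_extension_mult by fast

lemma extendable_const: "const_bcontfun c \<in> extendable"
  unfolding extendable_def using bounded_extension_const by fast

lemma extendable_ap_exp: "0 \<le> l \<Longrightarrow> ap_exp l \<in> extendable"
  unfolding extendable_def using bounded_extension_ap_exp by fast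

lemma extendable_sum: "(\<And>i. i \<in> I \<Longrightarrow> f i \<in> extendable) \<Longrightarrow> (\<Sum>i\<in>I. f i) \<in> extendable"
  using extendable_const[of 0]
  by (induction I rule: infinite_finite_induct) (auto intro: extendable_add)

lemma shift_sum:
  assumes "0 \<le> t" "\<And>i. i \<in> I \<Longrightarrow> f i \<in> extendable"
  shows "shift t (\<Sum>i\<in>I. f i) = (\<Sum>i\<in>I. shift t (f i))"
  using assms shift_const[of t 0]
  by (induction I rule: infinite_finite_induct) (auto simp: shift_add extendable_sum)

section \<open>Almost periodic functions with spectrum in a semigroup\<close>

definition trig_sum :: "(real \<Rightarrow> complex) \<Rightarrow> real set \<Rightarrow> real \<Rightarrow>\<^sub>C complex" where
  "trig_sum c F = (\<Sum>l\<in>F. const_bcontfun (c l) * ap_exp l)"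

definition exp_span :: "real set \<Rightarrow> (real \<Rightarrow>\<^sub>C complex) set" where
  "exp_span S = {trig_sum c F | c F. finite F \<and> F \<subseteq> S}"

lemma apply_sum_bcontfun: "apply_bcontfun (\<Sum>i\<in>I. f i) x = (\<Sum>i\<in>I. apply_bcontfun (f i) x)"
  by (induction I rule: infinite_finite_induct) auto

lemma const_bcontfun_add: "const_bcontfun (c + d) = const_bcontfun c + const_bcontfun d"
  and const_bcontfun_mult: "const_bcontfun (c * d) = const_bcontfun c * const_bcontfun d"
  and const_bcontfun_1: "const_bcontfun 1 = 1"
  by (auto intro!: bcontfun_eqI)

lemma ap_exp_add: "ap_exp (l + m) = ap_exp l * ap_exp m"
  by (rule bcontfun_eqI) (simp add: ap_exp.rep_eq exp_add[symmetric] algebra_simps)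

lemma ap_exp_0: "ap_exp 0 = 1"
  by (rule bcontfun_eqI) (simp add: ap_exp.rep_eq)

lemma trig_sum_extend:
  assumes "finite G" "F \<subseteq> G"
  shows "trig_sum c F = trig_sum (\<lambda>l. if l \<in> F then c l else 0) G"
  unfolding trig_sum_def using assms
  by (intro sum.mono_neutral_cong_left) auto

lemma exp_span_single: "l \<in> S \<Longrightarrow> const_bcontfun c * ap_exp l \<in> exp_span S"
  unfolding exp_span_def by (intro CollectI exI[of _ "\<lambda>_. c"] exI[of _ "{l}"]) (simp add: trig_sum_def)

lemma exp_span_zero: "0 \<in> exp_span S"
  unfolding exp_span_def by (intro CollectI exI[of _ "\<lambda>_. 0"] exI[of _ "{}"]) (simp add: trig_sum_def)

lemma exp_span_add:
  assumes "a \<in> exp_span S" "b \<in> exp_span S" shows "a + b \<in> exp_span S"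
proof -
  obtain c F d G where *: "a = trig_sum c F" "b = trig_sum d G" "finite F" "finite G" "F \<subseteq> S" "G \<subseteq> S"
    using assms by (auto simp: exp_span_def)
  let ?e = "\<lambda>l. (if l \<in> F then c l else 0) + (if l \<in> G then d l else 0)"
  have "a + b = trig_sum ?e (F \<union> G)"
    using trig_sum_extend[of "F \<union> G" F c] trig_sum_extend[of "F \<union> G" G d] *
    by (simp only: trig_sum_def const_bcontfun_add distrib_right sum.distrib finite_Un Un_upper1 Un_upper2)
  then show ?thesis
    unfolding exp_span_def using * by (intro CollectI exI[of _ ?e] exI[of _ "F \<union> G"]) simp
qed

lemma exp_span_sum: "(\<And>i. i \<in> I \<Longrightarrow> f i \<in> exp_span S) \<Longrightarrow> (\<Sum>i\<in>I. f i) \<in> exp_span S"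
  by (induction I rule: infinite_finite_induct) (auto intro: exp_span_zero exp_span_add)

lemma exp_span_mult:
  assumes "\<forall>l\<in>S. \<forall>m\<in>S. l + m \<in> S" "a \<in> exp_span S" "b \<in> exp_span S"
  shows "a * b \<in> exp_span S"
proof -
  obtain c F d G where *: "a = trig_sum c F" "b = trig_sum d G" "finite F" "finite G" "F \<subseteq> S" "G \<subseteq> S"
    using assms by (auto simp: exp_span_def)
  have "a * b = (\<Sum>l\<in>F. \<Sum>m\<in>G. const_bcontfun (c l * d m) * ap_exp (l + m))"
    unfolding * trig_sum_def sum_product
    by (intro sum.cong refl) (simp add: const_bcontfun_mult ap_exp_add mult_ac)
  also have "\<dots> \<in> exp_span S"
  proof (intro exp_span_sum exp_span_single)
    show "l + m \<in> S" if "l \<in> F" "m \<in> G" for l m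
      using assms(1) that * by auto
  qed
  finally show ?thesis .
qed

text \<open>For \<open>m \<noteq> 0\<close> the integral over \<open>[-N, N]\<close> stays bounded by \<open>2 / \<bar>m\<bar>\<close>.\<close>

lemma mean_of_exponential:
  "((\<lambda>N. (LBINT x:{-N..N}. exp (\<i> * of_real m * of_real x)) / of_real (2 * N))
     \<longlongrightarrow> (if m = 0 then 1 else 0)) at_top"
proof (cases "m = 0")
  case True
  have "eventually (\<lambda>N. (LBINT x:{-N..N}. exp (\<i> * of_real m * of_real x)) / of_real (2 * N) = 1) at_top"
    using eventually_gt_at_top[of "0::real"]
  proof eventually_elim
    case (elim N)
    then have "(LBINT x:{-N..N}. (1::complex)) = of_real (2 * N)"
      by (simp add: set_lebesgue_integral_def scaleR_conv_of_real)
    then show ?case using True elim by simp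
  qed
  then show ?thesis using True by (simp add: tendsto_eventually)
next
  case False
  let ?I = "\<lambda>N. LBINT x:{-N..N}. exp (\<i> * of_real m * of_real x)"
  have bound: "eventually (\<lambda>N. norm (?I N / of_real (2 * N)) \<le> 1 / (\<bar>m\<bar> * N)) at_top"
    using eventually_gt_at_top[of "0::real"]
  proof eventually_elim
    case (elim N)
    let ?F = "\<lambda>x :: real. exp (\<i> * of_real m * of_real x) / (\<i> * of_real m)"
    have "?I N = ?F N - ?F (- N)"
      unfolding set_lebesgue_integral_def
    proof (rule integral_FTC_atLeastAtMost)
      show "- N \<le> N" using elim by simp
      show "continuous_on {- N..N} (\<lambda>x. exp (\<i> * of_real m * of_real x))"
        by (intro continuous_intros)
      fix x
      have "((\<lambda>z. exp (\<i> * of_real m * z) / (\<i> * of_real m)) has_field_derivative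
          exp (\<i> * of_real m * of_real x)) (at (of_real x))"
        using False by (auto intro!: derivative_eq_intros)
      then show "(?F has_vector_derivative exp (\<i> * of_real m * of_real x)) (at x within {- N..N})"
        using has_vector_derivative_real_field has_vector_derivative_at_within by blast
    qed
    also have "norm \<dots> \<le> norm (?F N) + norm (?F (- N))" by (rule norm_triangle_ineq4)
    also have "\<dots> = 2 / \<bar>m\<bar>" using False by (simp add: norm_divide norm_mult norm_exp_eq_Re)
    finally have "norm (?I N) \<le> 2 / \<bar>m\<bar>" .
    then have "norm (?I N) / (2 * N) \<le> (2 / \<bar>m\<bar>) / (2 * N)"
      using elim by (intro divide_right_mono) auto
    then show ?case using elim by (simp add: norm_divide norm_mult)
  qed
  have "((\<lambda>N. 1 / (\<bar>m\<bar> * N)) \<longlongrightarrow> 0) at_top"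
    using False by (intro tendsto_divide_0[OF tendsto_const] filterlim_at_top_imp_at_infinity
        filterlim_tendsto_pos_mult_at_top[OF tendsto_const _ filterlim_ident]) auto
  then have "((\<lambda>N. ?I N / of_real (2 * N)) \<longlongrightarrow> 0) at_top"
    by (rule Lim_null_comparison[OF bound])
  then show ?thesis using False by simp
qed

lemma bohr_coefficient:
  assumes "finite F"
  shows "((\<lambda>N. (LBINT x:{-N..N}. trig_sum c F x * ap_exp (- m) x) / of_real (2 * N))
     \<longlongrightarrow> (if m \<in> F then c m else 0)) at_top"
proof -
  have integrand: "trig_sum c F x * ap_exp (- m) x = (\<Sum>l\<in>F. c l * exp (\<i> * of_real (l - m) * of_real x))" for x
    unfolding trig_sum_def apply_sum_bcontfun sum_distrib_right
    by (intro sum.cong refl)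
      (simp add: ap_exp.rep_eq mult.assoc exp_add[symmetric], simp add: algebra_simps)
  have int: "set_integrable lborel {-N..N} (\<lambda>x. c l * exp (\<i> * of_real (l - m) * of_real x))" for l N
    by (intro borel_integrable_atLeastAtMost' continuous_intros)
  have "(LBINT x:{-N..N}. trig_sum c F x * ap_exp (- m) x)
      = (\<Sum>l\<in>F. c l * (LBINT x:{-N..N}. exp (\<i> * of_real (l - m) * of_real x)))" for N
  proof -
    have "(LBINT x:{-N..N}. trig_sum c F x * ap_exp (- m) x)
        = (\<integral>x. (\<Sum>l\<in>F. indicator {-N..N} x *\<^sub>R (c l * exp (\<i> * of_real (l - m) * of_real x))) \<partial>lborel)"
      unfolding set_lebesgue_integral_def integrand scaleR_sum_right ..
    also have "\<dots> = (\<Sum>l\<in>F. LBINT x:{-N..N}. c l * exp (\<i> * of_real (l - m) * of_real x))"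
      using int unfolding set_lebesgue_integral_def set_integrable_def
      by (intro Bochner_Integration.integral_sum)
    finally show ?thesis by simp
  qed
  then have eq: "(LBINT x:{-N..N}. trig_sum c F x * ap_exp (- m) x) / of_real (2 * N)
      = (\<Sum>l\<in>F. c l * ((LBINT x:{-N..N}. exp (\<i> * of_real (l - m) * of_real x)) / of_real (2 * N)))" for N
    by (simp add: sum_divide_distrib)
  have "((\<lambda>N. \<Sum>l\<in>F. c l * ((LBINT x:{-N..N}. exp (\<i> * of_real (l - m) * of_real x)) / of_real (2 * N)))
      \<longlongrightarrow> (\<Sum>l\<in>F. c l * (if l - m = 0 then 1 else 0))) at_top"
    by (intro tendsto_intros mean_of_exponential)
  moreover have "(\<Sum>l\<in>F. c l * (if l - m = 0 then 1 else 0)) = (\<Sum>l\<in>F. if l = m then c m else 0)"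
    by (intro sum.cong) auto
  moreover have "\<dots> = (if m \<in> F then c m else 0)" using assms by simp
  ultimately show ?thesis unfolding eq by simp
qed

lemma bohr_spectrum_trig_sum:
  assumes "finite F" shows "bohr_spectrum (trig_sum c F) = {l \<in> F. c l \<noteq> 0}"
proof -
  have "(((\<lambda>N. (LBINT x:{-N..N}. trig_sum c F x * ap_exp (- m) x) / of_real (2 * N)) \<longlongrightarrow> d) at_top)
      \<longleftrightarrow> d = (if m \<in> F then c m else 0)" for m d
    using bohr_coefficient[OF assms, of c m]
      tendsto_unique[OF trivial_limit_at_top_linorder _ bohr_coefficient[OF assms, of c m], of d]
    by blast
  then show ?thesis unfolding bohr_spectrum_def by auto
qed

lemma AP0_eq: "AP0 = exp_span UNIV"
proof (intro equalityI subsetI)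
  fix a assume "a \<in> AP0"
  then obtain m :: nat and r l where "a = (\<Sum>j<m. const_bcontfun (r j) * ap_exp (l j))"
    by (auto simp: AP0_def)
  then show "a \<in> exp_span UNIV" by (auto intro!: exp_span_sum exp_span_single)
next
  fix a assume "a \<in> exp_span UNIV"
  then obtain c F where a: "a = trig_sum c F" "finite F" by (auto simp: exp_span_def)
  obtain h where h: "bij_betw h {0..<card F} F" using ex_bij_betw_nat_finite[OF a(2)] by blast
  have "a = (\<Sum>j<card F. const_bcontfun (c (h j)) * ap_exp (h j))"
    unfolding a trig_sum_def using sum.reindex_bij_betw[OF h, of "\<lambda>l. const_bcontfun (c l) * ap_exp l"]
    by (simp add: atLeast0LessThan)
  then show "a \<in> AP0" unfolding AP0_def
    by (intro CollectI exI[of _ "card F"] exI[of _ "\<lambda>j. c (h j)"] exI[of _ h])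
qed

text \<open>The Bohr--Fourier spectrum of an exponential sum with distinct frequencies consists of the
  frequencies with nonzero coefficient, so an almost periodic polynomial with spectrum in \<open>S\<close> can be
  rewritten with frequencies in \<open>S\<close> only.\<close>

lemma AP0_on_eq: "AP0_on S = exp_span S"
proof (intro equalityI subsetI)
  fix a assume "a \<in> AP0_on S"
  then obtain c F where a: "a = trig_sum c F" "finite F" and sp: "bohr_spectrum a \<subseteq> S"
    by (auto simp: AP0_on_def AP0_eq exp_span_def)
  let ?G = "{l \<in> F. c l \<noteq> 0}"
  have "a = trig_sum c ?G"
    unfolding a trig_sum_def using a(2) by (intro sum.mono_neutral_right) auto
  moreover have "?G \<subseteq> S" using sp bohr_spectrum_trig_sum[OF a(2)] a(1) by simp
  ultimately show "a \<in> exp_span S"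
    unfolding exp_span_def using a(2) by (intro CollectI exI[of _ c] exI[of _ ?G]) simp
next
  fix a assume "a \<in> exp_span S"
  then obtain c F where a: "a = trig_sum c F" "finite F" "F \<subseteq> S" by (auto simp: exp_span_def)
  have "a \<in> exp_span UNIV" unfolding exp_span_def using a by blast
  moreover have "bohr_spectrum a \<subseteq> S" using bohr_spectrum_trig_sum[OF a(2)] a by auto
  ultimately show "a \<in> AP0_on S" by (simp add: AP0_on_def AP0_eq)
qed

text \<open>Every closed subalgebra containing the exponentials contains all exponential sums and their limits,
  so taking the closure does not lead out of \<open>AP\<close>.\<close>

lemma AP_on_eq: "AP_on S = closure (exp_span S)"
proof -
  have span: "exp_span S \<subseteq> D" if D: "complex_subalgebra D" "range ap_exp \<subseteq> D" for D
  proof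
    fix a assume "a \<in> exp_span S"
    then obtain c F where a: "a = trig_sum c F" "finite F" by (auto simp: exp_span_def)
    have "(\<Sum>l\<in>F. const_bcontfun (c l) * ap_exp l) \<in> D"
      using a(2)
    proof (induction F)
      case empty
      then show ?case using D by (simp add: complex_subalgebra_def)
    next
      case (insert l F)
      moreover have "const_bcontfun (c l) * ap_exp l \<in> D"
        using D by (auto simp: complex_subalgebra_def)
      ultimately show ?case using D by (simp add: complex_subalgebra_def)
    qed
    then show "a \<in> D" by (simp add: a trig_sum_def)
  qed
  have "exp_span S \<subseteq> AP" unfolding AP_def using span by (intro Inter_greatest) auto
  moreover have "closed AP" unfolding AP_def by (intro closed_Inter) auto
  ultimately have "closure (exp_span S) \<subseteq> AP" by (rule closure_minimal)
  then show ?thesis by (auto simp: AP_on_def AP0_on_eq)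
qed

lemma closed_subalgebra_AP_on:
  assumes semigroup: "\<forall>l\<in>S. \<forall>m\<in>S. l + m \<in> S" and zero: "0 \<in> S"
  shows "closed_subalgebra const_bcontfun (AP_on S)"
proof
  show "closed (AP_on S)" by (simp add: AP_on_eq)
  have "const_bcontfun c \<in> exp_span S" for c
    using exp_span_single[OF zero, of c] by (simp add: ap_exp_0)
  then show "const_bcontfun c \<in> AP_on S" for c
    unfolding AP_on_eq using closure_subset by auto
  fix a b assume ab: "a \<in> AP_on S" "b \<in> AP_on S"
  obtain f where f: "\<And>n. f n \<in> exp_span S" "f \<longlonglongrightarrow> a"
    using ab(1) unfolding AP_on_eq closure_sequential by auto
  obtain g where g: "\<And>n. g n \<in> exp_span S" "g \<longlonglongrightarrow> b"
    using ab(2) unfolding AP_on_eq closure_sequential by auto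
  show "a + b \<in> AP_on S"
    unfolding AP_on_eq closure_sequential
    using exp_span_add f(1) g(1) tendsto_add[OF f(2) g(2)]
    by (intro exI[of _ "\<lambda>n. f n + g n"]) simp
  show "a * b \<in> AP_on S"
    unfolding AP_on_eq closure_sequential
    using exp_span_mult[OF semigroup f(1) g(1)] tendsto_mult[OF f(2) g(2)]
    by (intro exI[of _ "\<lambda>n. f n * g n"]) simp
qed (simp_all add: const_bcontfun_add const_bcontfun_mult const_bcontfun_1)

context
  fixes S :: "real set"
  assumes nonneg: "S \<subseteq> {0..}"
begin

lemma exp_span_extendable: "exp_span S \<subseteq> extendable"
proof
  fix a assume "a \<in> exp_span S"
  then obtain c F where "a = trig_sum c F" "F \<subseteq> S" by (auto simp: exp_span_def)
  then show "a \<in> extendable"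
    unfolding trig_sum_def using nonneg
    by (auto intro!: extendable_sum extendable_mult extendable_const extendable_ap_exp)
qed

lemma AP_on_extendable: "AP_on S \<subseteq> extendable"
  unfolding AP_on_eq by (rule closure_minimal[OF exp_span_extendable closed_extendable])

lemma shift_trig_sum:
  assumes "0 \<le> t" "F \<subseteq> S"
  shows "shift t (trig_sum c F) = trig_sum (\<lambda>l. c l * of_real (exp (- l * t))) F"
proof -
  have pos: "0 \<le> l" if "l \<in> F" for l using that assms nonneg by auto
  have "shift t (trig_sum c F) = (\<Sum>l\<in>F. shift t (const_bcontfun (c l) * ap_exp l))"
    unfolding trig_sum_def using assms pos
    by (intro shift_sum extendable_mult extendable_const extendable_ap_exp)
  also have "\<dots> = (\<Sum>l\<in>F. const_bcontfun (c l) * (const_bcontfun (of_real (exp (- l * t))) * ap_exp l))"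
  proof (intro sum.cong refl)
    fix l assume "l \<in> F"
    then show "shift t (const_bcontfun (c l) * ap_exp l)
        = const_bcontfun (c l) * (const_bcontfun (of_real (exp (- l * t))) * ap_exp l)"
      using shift_mult[OF assms(1) extendable_const extendable_ap_exp[OF pos], of l "c l"]
        shift_const[OF assms(1)] shift_ap_exp[OF assms(1) pos] by simp
  qed
  also have "\<dots> = trig_sum (\<lambda>l. c l * of_real (exp (- l * t))) F"
    by (simp add: trig_sum_def const_bcontfun_mult mult.assoc)
  finally show ?thesis .
qed

text \<open>Shifts are contractions, so an approximation of \<open>a\<close> by an exponential sum remains one, with the
  same error, for all shifts simultaneously.  This reduces the behaviour of \<open>shift t a\<close> in \<open>t\<close> to
  finite sums.\<close>

lemma shift_approx:
  assumes "a \<in> AP_on S" "0 < e"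
  obtains c F where "finite F" "F \<subseteq> S" "\<And>t. 0 \<le> t \<Longrightarrow> norm (shift t a - shift t (trig_sum c F)) < e"
proof -
  obtain b where b: "b \<in> exp_span S" "dist b a < e"
    using assms unfolding AP_on_eq closure_approachable by blast
  then obtain c F where F: "b = trig_sum c F" "finite F" "F \<subseteq> S" by (auto simp: exp_span_def)
  have ext: "a \<in> extendable" "b \<in> extendable"
    using assms(1) b(1) AP_on_extendable exp_span_extendable by auto
  have "norm (shift t a - shift t b) < e" if "0 \<le> t" for t
  proof -
    have "shift t a - shift t b = shift t (a - b)" using shift_diff[OF that ext] by simp
    moreover have "a - b \<in> extendable"
    proof -
      have "a - b = a + const_bcontfun (-1) * b" by (rule bcontfun_eqI) simp
      then show ?thesis using ext extendable_add extendable_mult extendable_const by metis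
    qed
    ultimately have "norm (shift t a - shift t b) \<le> norm (a - b)"
      using norm_shift_le[OF that] by simp
    then show ?thesis using b(2) by (simp add: dist_norm norm_minus_commute)
  qed
  then show thesis using that F by blast
qed

lemma shift_in_AP_on:
  assumes "a \<in> AP_on S" "0 \<le> t" shows "shift t a \<in> AP_on S"
  unfolding AP_on_eq closure_approachable
proof (intro allI impI)
  fix e :: real assume "0 < e"
  then obtain c F where F: "finite F" "F \<subseteq> S" "\<And>t. 0 \<le> t \<Longrightarrow> norm (shift t a - shift t (trig_sum c F)) < e"
    by (rule shift_approx[OF assms(1)]) (rule that)
  have "shift t (trig_sum c F) \<in> exp_span S"
    unfolding shift_trig_sum[OF assms(2) F(2)] exp_span_def using F by blast
  then show "\<exists>y\<in>exp_span S. dist y (shift t a) < e"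
    using F(3)[OF assms(2)]
    by (intro bexI[of _ "shift t (trig_sum c F)"]) (simp_all add: dist_norm norm_minus_commute)
qed

lemma tendsto_const_bcontfun:
  "(f \<longlongrightarrow> c) G \<Longrightarrow> ((\<lambda>t. const_bcontfun (f t) :: real \<Rightarrow>\<^sub>C complex) \<longlongrightarrow> const_bcontfun c) G"
proof -
  have "dist (const_bcontfun x :: real \<Rightarrow>\<^sub>C complex) (const_bcontfun y) = dist x y" for x y :: complex
  proof -
    have "const_bcontfun x - const_bcontfun y = (const_bcontfun (x - y) :: real \<Rightarrow>\<^sub>C complex)"
      by (rule bcontfun_eqI) simp
    then show ?thesis by (simp add: dist_norm)
  qed
  then show "(f \<longlongrightarrow> c) G \<Longrightarrow> ((\<lambda>t. const_bcontfun (f t) :: real \<Rightarrow>\<^sub>C complex) \<longlongrightarrow> const_bcontfun c) G"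
    by (simp add: tendsto_iff)
qed

lemma continuous_on_shift:
  assumes "a \<in> AP_on S" shows "continuous_on {0..} (\<lambda>t. shift t a)"
  unfolding continuous_on_iff
proof (intro ballI allI impI)
  fix t e :: real assume t: "t \<in> {0..}" and "0 < e"
  then have "0 < e / 3" by simp
  then obtain c F where F: "finite F" "F \<subseteq> S" "\<And>t. 0 \<le> t \<Longrightarrow> norm (shift t a - shift t (trig_sum c F)) < e / 3"
    by (rule shift_approx[OF assms]) (rule that)
  let ?p = "\<lambda>t. trig_sum (\<lambda>l. c l * of_real (exp (- l * t))) F"
  have "(?p \<longlongrightarrow> ?p t) (at t)"
    unfolding trig_sum_def by (intro tendsto_sum tendsto_mult tendsto_const tendsto_const_bcontfun tendsto_intros)
  then have "eventually (\<lambda>s. dist (?p s) (?p t) < e / 3) (at t)"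
    using \<open>0 < e / 3\<close> by (rule tendstoD)
  then obtain d where d: "d > 0" "\<And>s. s \<noteq> t \<Longrightarrow> dist s t < d \<Longrightarrow> dist (?p s) (?p t) < e / 3"
    unfolding eventually_at by auto
  have "dist (shift s a) (shift t a) < e" if s: "s \<in> {0..}" "dist s t < d" for s
  proof -
    have "dist (?p s) (?p t) < e / 3" using d(2)[of s] s \<open>0 < e / 3\<close> by (cases "s = t") auto
    moreover have "dist (shift s a) (?p s) < e / 3" "dist (shift t a) (?p t) < e / 3"
      using F(3)[of s] F(3)[of t] s t shift_trig_sum[OF _ F(2)] by (simp_all add: dist_norm)
    ultimately show ?thesis
      using dist_triangle[of "shift s a" "shift t a" "?p s"] dist_triangle[of "?p s" "shift t a" "?p t"]
      by (simp add: dist_commute)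
  qed
  then show "\<exists>d>0. \<forall>s\<in>{0..}. dist s t < d \<longrightarrow> dist (shift s a) (shift t a) < e"
    using d(1) by blast
qed

text \<open>For an exponential sum the terms of positive frequency are damped by \<open>exp (- l * t)\<close>, and only the
  constant term survives.\<close>

lemma shift_nearly_constant:
  assumes "a \<in> AP_on S" "0 < e"
  shows "\<exists>c. eventually (\<lambda>t. norm (const_bcontfun c - shift t a) < e) at_top"
proof -
  have "0 < e / 2" using assms by simp
  then obtain c F where F: "finite F" "F \<subseteq> S" "\<And>t. 0 \<le> t \<Longrightarrow> norm (shift t a - shift t (trig_sum c F)) < e / 2"
    by (rule shift_approx[OF assms(1)]) (rule that)
  let ?p = "\<lambda>t. trig_sum (\<lambda>l. c l * of_real (exp (- l * t))) F"
  let ?c = "if 0 \<in> F then c 0 else 0"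
  have "(?p \<longlongrightarrow> (\<Sum>l\<in>F. const_bcontfun (c l * of_real (if l = 0 then 1 else 0)) * ap_exp l)) at_top"
    unfolding trig_sum_def
  proof (intro tendsto_sum tendsto_mult tendsto_const tendsto_const_bcontfun tendsto_of_real)
    fix l assume "l \<in> F"
    then have "l \<ge> 0" using F nonneg by auto
    show "((\<lambda>t. exp (- l * t)) \<longlongrightarrow> (if l = 0 then 1 else 0)) at_top"
    proof (cases "l = 0")
      case False
      then have "l > 0" using \<open>l \<ge> 0\<close> by simp
      then have "filterlim (\<lambda>t. l * t) at_top at_top"
        by (intro filterlim_tendsto_pos_mult_at_top[OF tendsto_const _ filterlim_ident])
      then have "filterlim (\<lambda>t. - l * t) at_bot at_top"
        by (simp add: filterlim_uminus_at_top)
      then show ?thesis using False filterlim_compose[OF exp_at_bot] by simp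
    qed simp
  qed
  moreover have "(\<Sum>l\<in>F. const_bcontfun (c l * of_real (if l = 0 then 1 else 0)) * ap_exp l) = const_bcontfun ?c"
  proof -
    have "(\<Sum>l\<in>F. const_bcontfun (c l * of_real (if l = 0 then 1 else 0)) * ap_exp l)
        = (\<Sum>l\<in>F. if l = 0 then const_bcontfun (c 0) else 0)"
      by (intro sum.cong) (auto simp: ap_exp_0)
    then show ?thesis using F(1) by simp
  qed
  ultimately have "(?p \<longlongrightarrow> const_bcontfun ?c) at_top" by simp
  then have "eventually (\<lambda>t. dist (?p t) (const_bcontfun ?c) < e / 2) at_top"
    using \<open>0 < e / 2\<close> by (rule tendstoD)
  then have "eventually (\<lambda>t. norm (const_bcontfun ?c - shift t a) < e) at_top"
    using eventually_ge_at_top[of 0]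
  proof eventually_elim
    case (elim t)
    have "dist (shift t a) (?p t) < e / 2"
      using F(3)[OF elim(2)] shift_trig_sum[OF elim(2) F(2)] by (simp add: dist_norm)
    then have "dist (const_bcontfun ?c) (shift t a) < e"
      using elim(1) dist_triangle[of "const_bcontfun ?c" "shift t a" "?p t"] by (simp add: dist_commute)
    then show ?case by (simp add: dist_norm)
  qed
  then show ?thesis by blast
qed

end

section \<open>Completion of left invertible matrices\<close>

text \<open>The condition \<open>(\<Sum>I\<in>J. \<bar>\<psi> (f I)\<bar>) < e\<close> defines an open neighbourhood of \<open>\<phi>\<close> in the Gelfand topology,
  which therefore contains a point evaluation.\<close>

lemma half_plane_detects_characters:
  assumes dense: "half_plane_dense S" and \<phi>: "\<phi> \<in> characters S"
    and J: "finite J" "\<And>I. I \<in> J \<Longrightarrow> f I \<in> AP_on S" "\<And>I. I \<in> J \<Longrightarrow> \<phi> (f I) = 0" and e: "0 < e"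
  shows "\<exists>z\<in>upper_half_plane. (\<Sum>I\<in>J. cmod (poisson_ext (f I) z)) < e"
proof -
  define \<Phi> where "\<Phi> = (\<lambda>\<psi>. \<Sum>I\<in>J. cmod (\<psi> (f I)))"
  have "continuous_map (gelfand_topology S) euclideanreal \<Phi>"
    unfolding \<Phi>_def gelfand_topology_def
  proof (intro continuous_map_from_subtopology continuous_map_sum J(1) continuous_map_norm)
    show "continuous_map (product_topology (\<lambda>_. euclidean) (AP_on S)) euclidean (\<lambda>\<psi>. \<psi> (f I))"
      if "I \<in> J" for I
      using J(2)[OF that] by (rule continuous_map_product_projection)
  qed
  then have U: "openin (gelfand_topology S) {\<psi> \<in> topspace (gelfand_topology S). \<Phi> \<psi> \<in> {..<e}}"
    (is "openin _ ?U") by (rule openin_continuous_map_preimage) auto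
  have "\<Phi> \<phi> = 0" unfolding \<Phi>_def using J(3) by simp
  have \<phi>: "\<phi> \<in> gelfand_topology S closure_of (eval_character S ` upper_half_plane)"
    using dense \<phi> by (simp add: half_plane_dense_def)
  then have "\<phi> \<in> ?U" using \<open>\<Phi> \<phi> = 0\<close> e by (simp add: in_closure_of)
  then have "\<exists>\<psi>. \<psi> \<in> eval_character S ` upper_half_plane \<and> \<psi> \<in> ?U"
    by (rule mp[OF spec[OF conjunct2[OF iffD1[OF in_closure_of \<phi>]]] conjI[OF _ U]])
  then obtain z where z: "z \<in> upper_half_plane" "\<Phi> (eval_character S z) < e" by auto
  moreover have "\<Phi> (eval_character S z) = (\<Sum>I\<in>J. cmod (poisson_ext (f I) z))"
    unfolding \<Phi>_def eval_character_def using J(2) by simp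
  ultimately show ?thesis by auto
qed

context
  fixes S :: "real set"
  assumes nonneg: "S \<subseteq> {0..}" and semigroup: "\<forall>l\<in>S. \<forall>m\<in>S. l + m \<in> S" and zero: "0 \<in> S"
begin

interpretation AP: closed_subalgebra const_bcontfun "AP_on S"
  by (rule closed_subalgebra_AP_on[OF semigroup zero])

lemma left_inverse_exists:
  assumes dense: "half_plane_dense S" and A: "A \<in> AP.mats n k"
    and inf: "0 < (INF z\<in>upper_half_plane. \<Sum>I | I \<subseteq> {0..<n} \<and> card I = k.
               cmod (poisson_ext (Determinant.det (submatrix A I {0..<k})) z))"
  shows "\<exists>L\<in>AP.mats k n. L * A = 1\<^sub>m k"
proof (rule ccontr)
  assume "\<not> ?thesis"
  then obtain \<phi> where \<phi>: "\<phi> \<in> extensional (AP_on S)" "\<phi> 1 = 1"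
    "\<And>I. I \<subseteq> {0..<n} \<Longrightarrow> card I = k \<Longrightarrow> \<phi> (Determinant.det (submatrix A I {0..<k})) = 0"
    "\<And>a b. a \<in> AP_on S \<Longrightarrow> b \<in> AP_on S \<Longrightarrow> \<phi> (a + b) = \<phi> a + \<phi> b"
    "\<And>a b. a \<in> AP_on S \<Longrightarrow> b \<in> AP_on S \<Longrightarrow> \<phi> (a * b) = \<phi> a * \<phi> b"
    "\<And>c a. a \<in> AP_on S \<Longrightarrow> \<phi> (const_bcontfun c * a) = c * \<phi> a"
    by (rule AP.left_inverse_or_character[OF A]) (rule that)
  let ?J = "{I. I \<subseteq> {0..<n} \<and> card I = k}"
  let ?f = "\<lambda>I. Determinant.det (submatrix A I {0..<k})"
  let ?s = "\<lambda>z. \<Sum>I\<in>?J. cmod (poisson_ext (?f I) z)"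
  have "\<phi> \<in> characters S"
    unfolding characters_def using \<phi>(1,2,4-6) AP.one_in
    by (intro CollectI conjI ballI allI bexI[of _ 1]) auto
  then have "\<exists>z\<in>upper_half_plane. ?s z < (INF z\<in>upper_half_plane. ?s z)"
  proof (rule half_plane_detects_characters[OF dense])
    show "finite ?J" by (rule finite_subset[of _ "Pow {0..<n}"]) auto
    show "?f I \<in> AP_on S" if "I \<in> ?J" for I
      using that by (intro AP.det_in[OF AP.minor_in[OF A]]) auto
    show "\<phi> (?f I) = 0" if "I \<in> ?J" for I using that \<phi>(3) by simp
  qed (rule inf)
  then obtain z where z: "z \<in> upper_half_plane" "?s z < (INF z\<in>upper_half_plane. ?s z)" by blast
  have "(INF z\<in>upper_half_plane. ?s z) \<le> ?s z"
    by (rule cINF_lower[OF bdd_belowI2[of _ 0] z(1)]) (auto intro: sum_nonneg)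
  then show False using z(2) by simp
qed

lemma map_shift_mats:
  "0 \<le> t \<Longrightarrow> A \<in> AP.mats n m \<Longrightarrow> map_mat (shift t) A \<in> AP.mats n m"
  by (auto simp: AP.mats_def intro!: shift_in_AP_on[OF nonneg])

lemma map_shift_left_inverse:
  assumes t: "0 \<le> t" and A: "A \<in> AP.mats n k" and L: "L \<in> AP.mats k n" "L * A = 1\<^sub>m k"
  shows "map_mat (shift t) L * map_mat (shift t) A = 1\<^sub>m k"
proof (rule eq_matI)
  note ext = subsetD[OF AP_on_extendable[OF nonneg]]
  note c = AP.mats_carrier[OF A] AP.mats_carrier[OF L(1)]
  fix i j assume "i < dim_row (1\<^sub>m k :: (real \<Rightarrow>\<^sub>C complex) mat)" "j < dim_col (1\<^sub>m k :: (real \<Rightarrow>\<^sub>C complex) mat)"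
  then have ij: "i < k" "j < k" by auto
  have e: "L $$ (i, l) \<in> extendable" "A $$ (l, j) \<in> extendable" if "l < n" for l
    using that ij ext AP.mats_entry[OF L(1)] AP.mats_entry[OF A] by auto
  have "(map_mat (shift t) L * map_mat (shift t) A) $$ (i, j)
      = (\<Sum>l<n. map_mat (shift t) L $$ (i, l) * map_mat (shift t) A $$ (l, j))"
    using c ij by (intro mult_mat_entry[of _ k n _ k]) auto
  also have "\<dots> = (\<Sum>l<n. shift t (L $$ (i, l) * A $$ (l, j)))"
    using c ij e t by (intro sum.cong) (auto simp: shift_mult)
  also have "\<dots> = shift t (\<Sum>l<n. L $$ (i, l) * A $$ (l, j))"
    using e by (intro shift_sum[symmetric] t extendable_mult) auto
  also have "(\<Sum>l<n. L $$ (i, l) * A $$ (l, j)) = (1\<^sub>m k :: (real \<Rightarrow>\<^sub>C complex) mat) $$ (i, j)"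
    using mult_mat_entry[OF c(2,1) ij] L(2) by simp
  also have "\<dots> = const_bcontfun (if i = j then 1 else 0)"
    using ij by (simp add: const_bcontfun_1)
  also have "shift t \<dots> = const_bcontfun (if i = j then 1 else 0)" by (rule shift_const[OF t])
  also have "\<dots> = 1\<^sub>m k $$ (i, j)" using ij by (simp add: const_bcontfun_1)
  finally show "(map_mat (shift t) L * map_mat (shift t) A) $$ (i, j) = 1\<^sub>m k $$ (i, j)" .
qed (use AP.mats_carrier[OF A] AP.mats_carrier[OF L(1)] in auto)

lemma gl_equiv_shift:
  assumes t: "0 \<le> t" and A: "A \<in> AP.mats n k" and L: "L \<in> AP.mats k n" "L * A = 1\<^sub>m k"
  shows "AP.gl_equiv n A (map_mat (shift t) A)"
proof -
  note c = AP.mats_carrier[OF A]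
  have "map_mat (shift 0) A = A"
    using c AP.mats_entry[OF A] subsetD[OF AP_on_extendable[OF nonneg]]
    by (intro eq_matI) (auto simp: shift_0)
  moreover have "AP.gl_equiv n (map_mat (shift 0) A) (map_mat (shift t) A)"
  proof (rule AP.gl_equiv_path[where J = "{0..}" and k = k])
    show "map_mat (shift s) A \<in> AP.mats n k" if "s \<in> {0..}" for s
      using that A by (intro map_shift_mats) auto
    show "continuous_on {0..} (\<lambda>s. map_mat (shift s) A $$ (i, j))" if "i < n" "j < k" for i j
      using that c continuous_on_shift[OF nonneg AP.mats_entry[OF A that]] by simp
    show "\<exists>L\<in>AP.mats k n. L * map_mat (shift s) A = 1\<^sub>m k" if "s \<in> {0..}" for s
      using that map_shift_left_inverse[OF _ A L] map_shift_mats[OF _ L(1)] by auto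
  qed (use t in auto)
  ultimately show ?thesis by simp
qed

text \<open>Far along the deformation the shifted matrices come arbitrarily close to constant ones.  Their
  left inverses, the shifts of \<open>L\<close>, stay bounded because shifts are contractions, so perturbation
  applies in the limit.\<close>

lemma gl_equiv_constant_matrix:
  assumes A: "A \<in> AP.mats n k" and L: "L \<in> AP.mats k n" "L * A = 1\<^sub>m k"
  obtains C where "C \<in> carrier_mat n k" "AP.gl_equiv n A (map_mat const_bcontfun C)"
proof -
  note c = AP.mats_carrier[OF A]
  have "\<exists>t C. 0 \<le> t \<and> C \<in> carrier_mat n k \<and>
      (\<forall>i<n. \<forall>j<k. norm (const_bcontfun (C $$ (i, j)) - shift t (A $$ (i, j))) < e)" if e: "0 < e" for e
  proof -
    have "\<forall>i j. \<exists>d. i < n \<and> j < k \<longrightarrow>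
        eventually (\<lambda>t. norm (const_bcontfun d - shift t (A $$ (i, j))) < e) at_top"
      using shift_nearly_constant[OF nonneg AP.mats_entry[OF A] e] by blast
    then obtain D where D: "\<And>i j. i < n \<Longrightarrow> j < k \<Longrightarrow>
        eventually (\<lambda>t. norm (const_bcontfun (D i j) - shift t (A $$ (i, j))) < e) at_top"
      by metis
    have "eventually (\<lambda>t. \<forall>i\<in>{..<n}. \<forall>j\<in>{..<k}.
        norm (const_bcontfun (D i j) - shift t (A $$ (i, j))) < e) at_top"
      using D by (intro eventually_ball_finite ballI) auto
    then have "eventually (\<lambda>t. 0 \<le> t \<and> (\<forall>i\<in>{..<n}. \<forall>j\<in>{..<k}.
        norm (const_bcontfun (D i j) - shift t (A $$ (i, j))) < e)) at_top"
      using eventually_ge_at_top[of 0] by eventually_elim simp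
    then obtain t where "0 \<le> t" "\<forall>i\<in>{..<n}. \<forall>j\<in>{..<k}.
        norm (const_bcontfun (D i j) - shift t (A $$ (i, j))) < e"
      using eventually_happens'[OF trivial_limit_at_top_linorder] by blast
    then show ?thesis
      by (intro exI[of _ t] exI[of _ "Matrix.mat n k (\<lambda>(i, j). D i j)"]) simp
  qed
  then have "\<forall>m. \<exists>t C. 0 \<le> t \<and> C \<in> carrier_mat n k \<and>
      (\<forall>i<n. \<forall>j<k. norm (const_bcontfun (C $$ (i, j)) - shift t (A $$ (i, j))) < inverse (real (Suc m)))"
    by simp
  then obtain \<tau> C where \<tau>: "\<And>m. 0 \<le> \<tau> m" and C: "\<And>m. C m \<in> carrier_mat n k"
    and close: "\<And>m i j. i < n \<Longrightarrow> j < k \<Longrightarrow>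
      norm (const_bcontfun (C m $$ (i, j)) - shift (\<tau> m) (A $$ (i, j))) < inverse (real (Suc m))"
    by metis
  obtain K where K: "\<And>i j. i < k \<Longrightarrow> j < n \<Longrightarrow> norm (L $$ (i, j)) \<le> K"
    by (rule mat_entries_bounded) (rule that)
  have "eventually (\<lambda>m. AP.gl_equiv n (map_mat (shift (\<tau> m)) A) (map_mat const_bcontfun (C m))) sequentially"
  proof (rule AP.gl_equiv_perturbation)
    have "norm (map_mat (shift (\<tau> m)) L $$ (i, j)) \<le> K" if "i < k" "j < n" for m i j
    proof -
      have "L $$ (i, j) \<in> extendable"
        using AP.mats_entry[OF L(1) that] AP_on_extendable[OF nonneg] by blast
      then have "norm (shift (\<tau> m) (L $$ (i, j))) \<le> norm (L $$ (i, j))"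
        by (rule norm_shift_le[OF \<tau>])
      then show ?thesis using K[OF that] that AP.mats_carrier[OF L(1)] by simp
    qed
    then show "eventually (\<lambda>m. map_mat (shift (\<tau> m)) A \<in> AP.mats n k \<and>
        map_mat const_bcontfun (C m) \<in> AP.mats n k \<and> map_mat (shift (\<tau> m)) L \<in> AP.mats k n \<and>
        map_mat (shift (\<tau> m)) L * map_mat (shift (\<tau> m)) A = 1\<^sub>m k \<and>
        (\<forall>i<k. \<forall>j<n. norm (map_mat (shift (\<tau> m)) L $$ (i, j)) \<le> K)) sequentially"
      using map_shift_mats[OF \<tau> A] map_shift_mats[OF \<tau> L(1)] AP.mats_map_scal[OF C]
        map_shift_left_inverse[OF \<tau> A L] by (intro always_eventually) simp
    fix i j assume ij: "i < n" "j < k"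
    show "((\<lambda>m. map_mat const_bcontfun (C m) $$ (i, j) - map_mat (shift (\<tau> m)) A $$ (i, j)) \<longlongrightarrow> 0) sequentially"
    proof (rule Lim_null_comparison[OF _ LIMSEQ_inverse_real_of_nat])
      have "norm (map_mat const_bcontfun (C m) $$ (i, j) - map_mat (shift (\<tau> m)) A $$ (i, j)) \<le> inverse (real (Suc m))" for m
        using less_imp_le[OF close[OF ij, of m]] C[of m] c ij by simp
      then show "\<forall>\<^sub>F m in sequentially. norm (map_mat const_bcontfun (C m) $$ (i, j)
          - map_mat (shift (\<tau> m)) A $$ (i, j)) \<le> inverse (real (Suc m))"
        by (intro always_eventually allI)
    qed
  qed
  then obtain m where "AP.gl_equiv n (map_mat (shift (\<tau> m)) A) (map_mat const_bcontfun (C m))"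
    using eventually_happens'[OF trivial_limit_sequentially] by blast
  then have "AP.gl_equiv n A (map_mat const_bcontfun (C m))"
    using AP.gl_equiv_trans[OF A gl_equiv_shift[OF \<tau> A L]] by blast
  then show thesis using that C by blast
qed

text \<open>The matrix \<open>C\<close> inherits a left inverse over \<open>AP_on S\<close> through the equivalence; evaluating all
  entries at one point of the real line turns it into a complex one and leaves \<open>C\<close> unchanged.\<close>

lemma constant_left_inverse:
  assumes A: "A \<in> AP.mats n k" and L: "L \<in> AP.mats k n" "L * A = 1\<^sub>m k"
    and C: "C \<in> carrier_mat n k" and equiv: "AP.gl_equiv n A (map_mat const_bcontfun C)"
  shows "\<exists>L0\<in>carrier_mat k n. L0 * C = 1\<^sub>m k"
proof -
  let ?ev = "\<lambda>f :: real \<Rightarrow>\<^sub>C complex. apply_bcontfun f 0"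
  interpret ev: comm_ring_hom ?ev by unfold_locales auto
  obtain H where H: "H \<in> AP.mats n n" "A = H * map_mat const_bcontfun C"
    using AP.gl_equiv_sym[OF A equiv] by (auto simp: AP.gl_equiv_def)
  note c = AP.mats_carrier[OF L(1)] AP.mats_carrier[OF H(1)]
  have cC: "map_mat const_bcontfun C \<in> carrier_mat n k" using C by simp
  have "(L * H) * map_mat const_bcontfun C = L * A"
    unfolding H(2) by (rule assoc_mult_mat[OF c cC])
  then have "map_mat ?ev (L * H) * map_mat ?ev (map_mat const_bcontfun C) = map_mat ?ev (1\<^sub>m k)"
    using ev.mat_hom_mult[OF mult_carrier_mat[OF c] cC] L(2) by simp
  moreover have "map_mat ?ev (map_mat const_bcontfun C) = C"
    by (intro eq_matI) auto
  ultimately have "map_mat ?ev (L * H) * C = 1\<^sub>m k" by (simp add: ev.mat_hom_one)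
  moreover have "map_mat ?ev (L * H) \<in> carrier_mat k n" using c by auto
  ultimately show ?thesis by blast
qed

lemma completion_of_left_invertible:
  assumes A: "A \<in> AP.mats n k" and L: "L \<in> AP.mats k n" "L * A = 1\<^sub>m k" and "k < n"
  shows "\<exists>D\<in>AP.mats n n. (\<forall>i<n. \<forall>j<k. D $$ (i, j) = A $$ (i, j)) \<and> Determinant.det D = 1"
proof -
  obtain C where C: "C \<in> carrier_mat n k" "AP.gl_equiv n A (map_mat const_bcontfun C)"
    by (rule gl_equiv_constant_matrix[OF A L]) (rule that)
  obtain L0 where L0: "L0 \<in> carrier_mat k n" "L0 * C = 1\<^sub>m k"
    using constant_left_inverse[OF A L C] by blast
  have "AP.gl_equiv n (std_frame n k) (map_mat const_bcontfun C)"
    by (rule AP.gl_equiv_constant[OF C(1) L0]) (use assms(4) in simp)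
  moreover have "std_frame n k \<in> AP.mats n k"
    by (auto simp: AP.mats_def std_frame_def AP.one_in AP.zero_in)
  ultimately have "AP.gl_equiv n (std_frame n k) A"
    using AP.gl_equiv_trans AP.gl_equiv_sym[OF A C(2)] by blast
  then show ?thesis using assms(4) by (rule AP.completion_if_gl_equiv_std_frame)
qed

end

theorem theorem1p3:
  fixes S :: "real set" and n k :: nat and A :: "(real \<Rightarrow>\<^sub>C complex) mat"
  assumes "S \<subseteq> {0..}" and "\<forall>l\<in>S. \<forall>m\<in>S. l + m \<in> S" and "0 \<in> S"
    and "half_plane_dense S"
    and "1 \<le> k" and "k < n"
    and "A \<in> carrier_mat n k"
    and "\<forall>i<n. \<forall>j<k. A $$ (i, j) \<in> AP_on S"
    and "0 < (INF z\<in>upper_half_plane. \<Sum>I | I \<subseteq> {0..<n} \<and> card I = k.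
               cmod (poisson_ext (Determinant.det (submatrix A I {0..<k})) z))"
  shows "\<exists>B \<in> carrier_mat n n.
           (\<forall>i<n. \<forall>j<n. B $$ (i, j) \<in> AP_on S) \<and>
           (\<forall>i<n. \<forall>j<k. B $$ (i, j) = A $$ (i, j)) \<and>
           Determinant.det B = 1"
proof -
  interpret AP: closed_subalgebra const_bcontfun "AP_on S"
    by (rule closed_subalgebra_AP_on[OF assms(2,3)])
  have A: "A \<in> AP.mats n k" using assms(7,8) by (simp add: AP.mats_def)
  obtain L where "L \<in> AP.mats k n" "L * A = 1\<^sub>m k"
    using left_inverse_exists[OF assms(1-4) A assms(9)] by blast
  then obtain D where "D \<in> AP.mats n n" "\<forall>i<n. \<forall>j<k. D $$ (i, j) = A $$ (i, j)" "Determinant.det D = 1"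
    using completion_of_left_invertible[OF assms(1-3) A _ _ assms(6)] by blast
  then show ?thesis unfolding AP.mats_def by blast
qed

end
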